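(* Let $\{x_t\},\{\bar x_t\},\{y_t\}$ be generated by the AC-PDHG iteration (defined in the context) with $\mu_d>0$, $\eta_1>0$, $\beta_1=0$, $\beta_t=\beta$ for $t\ge2$ with $\beta\in(0,1-\frac{\sqrt6}{3}]$, $\tau_1=0$, $\tau_2=\mu_d$, $\eta_2=\min\{(1-\beta)\eta_1,\frac{\mu_d}{4L_{A,1}^2}\}$, and for $t\ge3$ $$\eta_t=\min\Big\{\tfrac43\eta_{t-1},\ \frac{\tau_{t-2}+\mu_d}{\tau_{t-1}}\eta_{t-1},\ \frac{\tau_{t-1}}{4L_{A,t-1}^2}\Big\},\qquad \tau_t=\tau_{t-1}+\frac{\mu_d}{2}\Big[\alpha+(1-\alpha)\eta_t\cdot\frac{4L_{A,t-1}^2}{\tau_{t-1}}\Big]$$ for some absolute constant $\alpha\in(0,1]$. Then for all $t\ge2$, $$\eta_t\ge\frac{(3+\alpha(t-3))\mu_d}{12\widehat L_{A,t-1}^2},\qquad\text{where } \widehat L_{A,t}:=\max\Big\{\sqrt{\tfrac{\mu_d}{4(1-\beta)\eta_1}},L_{A,1},\dots,L_{A,t}\Big\}.$$ Consequently, for every $k\ge2$ and every $z=(x,y)\in Z$, $$Q(\widehat z_k,z)-\frac{\mu_d}{2}\|\widetilde y_0-y\|^2+\frac{\mu_d}{2}\|\widetilde y_0-\widehat y_k\|^2+\frac{\mu_d}{2}\|\widetilde y_k-y\|^2\le\frac{12\widehat L_{A,k}^2}{\mu_d(6k+\alpha k(k-3))}\Big[\frac{\|x_0-x\|^2-\|\bar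 x_{k+1}-x\|^2}{\beta}+\eta_2\Big(\frac{5L_{A,1}^2}{2\mu_d}-\frac1{\eta_1}\Big)\|x_1-x_0\|^2\Big].$$ Moreover, if $\max_{x\in X}\|x-x_0\|^2\le D_X^2$ and $\max_{y\in Y}\|y-\widetilde y_0\|^2\le D_Y^2$, then for every $k\ge2$ $$\max_{z\in Z}Q(\widehat z_k,z)\le\frac{12\widehat L_{A,k}^2}{\mu_d(6k+\alpha k(k-3))}\Big(\frac1\beta+\frac58\Big)D_X^2+\frac{\mu_d}{2}D_Y^2.$$ Here $$\widehat x_k=\frac{\sum_{t=1}^k\eta_{t+1}x_t}{\sum_{t=1}^k\eta_{t+1}},\quad \widehat y_k=\frac{\sum_{t=1}^k\eta_{t+1}y_t}{\sum_{t=1}^k\eta_{t+1}},\quad \widehat z_k=(\widehat x_k,\widehat y_k),$$ $$\widetilde y_k=\frac{\sum_{t=1}^{k-1}\big(\eta_{t+1}(\mu_d+\tau_t)-\eta_{t+2}\tau_{t+1}\big)y_t+\eta_{k+1}(\mu_d+\tau_k)y_k}{\mu_d\sum_{t=1}^k\eta_{t+1}}.$$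
   Context: Setting: $X\subseteq\mathbb{R}^n$ and $Y\subseteq\mathbb{R}^m$ are nonempty closed convex sets, $Z=X\times Y$, $A\in\mathbb{R}^{m\times n}$, and $f:X\to\mathbb{R}$, $g:Y\to\mathbb{R}$ are proper, lower semicontinuous, convex functions. All norms are Euclidean. The problem $\min_{x\in X}\max_{y\in Y} f(x)+\langle Ax,y\rangle-g(y)$ is assumed to have a saddle point. For $\bar z=(\bar x,\bar y)\in Z$ and $z=(x,y)\in Z$, the gap function is $Q(\bar z,z)=f(\bar x)+\langle A\bar x,y\rangle-g(y)-[f(x)+\langle Ax,\bar y\rangle-g(\bar y)]$. AC-PDHG iteration: given $x_0=\bar x_0\in X$, $\widetilde y_0\in Y$, $\mu_d>0$ and parameters $\beta_t\in[0,1)$, $\eta_t$, $\tau_t$, set $y_0=\arg\min_{y\in Y}\{\langle -Ax_0,y\rangle+g(y)+\frac{\mu_d}{2}\|\widetilde y_0-y\|^2\}$, and for $t=1,2,\dots$ - $x_t=\arg\min_{x\in X}\{\eta_t[\langle A^\top y_{t-1},x\rangle+f(x)]+\frac12\|\bar x_{t-1}-x\|^2\}$, - $\bar x_t=(1-\beta_t)\bar x_{t-1}+\beta_t x_t$, - $y_t=\arg\min_{y\in Y}\{\langle -Ax_t,y\rangle+g(y)+\frac{\mu_d}{2}\|\widetilde y_0-y\|^2+\frac{\tau_t}{2}\|y_{t-1}-y\|^2\}$. Local norm estimates: $L_{A,t}=\|A^\top(y_t-y_{t-1})\|/\|y_t-y_{t-1}\|$ for $t\ge1$. Conventions: $0/0=0$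 and $a/0=+\infty$ for $a>0$.
   Formalization: The second display is false as printed when the bracket [...] is negative; it is proved when the bracket is nonnegative, and for every z with the factor 1/(2(η_2+...+η_{k+1})) in place of 12L̂²_{A,k}/(μ_d(6k+αk(k-3))). *)

theory Defs
  imports "HOL-Analysis.Analysis"
begin

definition lsc_on :: "'a::topological_space set \<Rightarrow> ('a \<Rightarrow> real) \<Rightarrow> bool" where
  "lsc_on S f \<longleftrightarrow> (\<forall>x\<in>S. \<forall>c<f x. eventually (\<lambda>u. c < f u) (at x within S))"

definition lagrangian ::
  "real^'n^'m \<Rightarrow> (real^'n \<Rightarrow> real) \<Rightarrow> (real^'m \<Rightarrow> real) \<Rightarrow> real^'n \<Rightarrow> real^'m \<Rightarrow> real" where
  "lagrangian A f g x y = f x + (A *v x) \<bullet> y - g y"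

definition saddle_point ::
  "(real^'n) set \<Rightarrow> (real^'m) set \<Rightarrow> real^'n^'m \<Rightarrow> (real^'n \<Rightarrow> real) \<Rightarrow> (real^'m \<Rightarrow> real)
    \<Rightarrow> (real^'n) \<times> (real^'m) \<Rightarrow> bool" where
  "saddle_point X Y A f g z \<longleftrightarrow> z \<in> X \<times> Y \<and>
     (\<forall>x\<in>X. \<forall>y\<in>Y. lagrangian A f g (fst z) y \<le> lagrangian A f g (fst z) (snd z) \<and>
                    lagrangian A f g (fst z) (snd z) \<le> lagrangian A f g x (snd z))"

definition gap ::
  "real^'n^'m \<Rightarrow> (real^'n \<Rightarrow> real) \<Rightarrow> (real^'m \<Rightarrow> real)
    \<Rightarrow> (real^'n) \<times> (real^'m) \<Rightarrow> (real^'n) \<times> (real^'m) \<Rightarrow> real" where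
  "gap A f g zb z = lagrangian A f g (fst zb) (snd z) - lagrangian A f g (fst z) (snd zb)"

text \<open>
  The iteration is a predicate on the generated sequences. Every subproblem below has a strongly
  convex, lower semicontinuous objective when \<open>\<mu> > 0\<close>, \<open>\<eta> t \<ge> 0\<close> and
  \<open>\<tau> t \<ge> 0\<close>, so its minimiser exists and is unique and \<^const>\<open>is_arg_min\<close> determines
  the iterate. The functions \<open>f\<close> and \<open>g\<close> are only evaluated on \<open>X\<close> and \<open>Y\<close>.
\<close>

definition ac_pdhg ::
  "(real^'n) set \<Rightarrow> (real^'m) set \<Rightarrow> real^'n^'m \<Rightarrow> (real^'n \<Rightarrow> real) \<Rightarrow> (real^'m \<Rightarrow> real)
    \<Rightarrow> real \<Rightarrow> (nat \<Rightarrow> real) \<Rightarrow> (nat \<Rightarrow> real) \<Rightarrow> (nat \<Rightarrow> real)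
    \<Rightarrow> real^'m \<Rightarrow> (nat \<Rightarrow> real^'n) \<Rightarrow> (nat \<Rightarrow> real^'n) \<Rightarrow> (nat \<Rightarrow> real^'m) \<Rightarrow> bool" where
  "ac_pdhg X Y A f g \<mu> \<beta> \<eta> \<tau> ytil0 x xbar y \<longleftrightarrow>
     \<mu> > 0 \<and> (\<forall>t\<ge>1. 0 \<le> \<beta> t \<and> \<beta> t < 1) \<and>
     x 0 \<in> X \<and> xbar 0 = x 0 \<and> ytil0 \<in> Y \<and>
     is_arg_min (\<lambda>v. (- (A *v x 0)) \<bullet> v + g v + \<mu> / 2 * (norm (ytil0 - v))\<^sup>2)
       (\<lambda>v. v \<in> Y) (y 0) \<and>
     (\<forall>t\<ge>1.
        is_arg_min (\<lambda>u. \<eta> t * ((transpose A *v y (t - 1)) \<bullet> u + f u)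
                        + 1 / 2 * (norm (xbar (t - 1) - u))\<^sup>2)
          (\<lambda>u. u \<in> X) (x t) \<and>
        xbar t = (1 - \<beta> t) *\<^sub>R xbar (t - 1) + \<beta> t *\<^sub>R x t \<and>
        is_arg_min (\<lambda>v. (- (A *v x t)) \<bullet> v + g v + \<mu> / 2 * (norm (ytil0 - v))\<^sup>2
                        + \<tau> t / 2 * (norm (y (t - 1) - v))\<^sup>2)
          (\<lambda>v. v \<in> Y) (y t))"

text \<open>For \<open>y t = y (t - 1)\<close> this is \<open>0 / 0 = 0\<close>, as intended.\<close>

definition local_norm :: "real^'n^'m \<Rightarrow> (nat \<Rightarrow> real^'m) \<Rightarrow> nat \<Rightarrow> real" where
  "local_norm A y t =
     norm (transpose A *v (y t - y (t - 1))) / norm (y t - y (t - 1))"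

definition max_local_norm ::
  "real^'n^'m \<Rightarrow> (nat \<Rightarrow> real^'m) \<Rightarrow> real \<Rightarrow> real \<Rightarrow> real \<Rightarrow> nat \<Rightarrow> real" where
  "max_local_norm A y \<mu> \<beta> \<eta>1 t =
     Max (insert (sqrt (\<mu> / (4 * (1 - \<beta>) * \<eta>1))) (local_norm A y ` {1..t}))"

text \<open>
  The step-size recursions are stated in \<^typ>\<open>ereal\<close>, where \<open>a / 0 = \<infinity>\<close> for \<open>a > 0\<close>:
  a vanishing local norm imposes no bound on the step size. (Over \<^typ>\<open>real\<close>, division by zero
  would yield \<open>0\<close>.) The division by \<open>\<tau> (t - 1)\<close> is harmless, as \<open>\<tau>\<close> is positive from
  index \<open>2\<close> on.
\<close>

definition ac_pdhg_steps ::
  "real^'n^'m \<Rightarrow> (nat \<Rightarrow> real^'m) \<Rightarrow> real \<Rightarrow> real \<Rightarrow> real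
    \<Rightarrow> (nat \<Rightarrow> real) \<Rightarrow> (nat \<Rightarrow> real) \<Rightarrow> (nat \<Rightarrow> real) \<Rightarrow> bool" where
  "ac_pdhg_steps A y \<mu> \<alpha> \<beta> \<beta>s \<eta> \<tau> \<longleftrightarrow>
     \<eta> 1 > 0 \<and> \<beta>s 1 = 0 \<and> (\<forall>t\<ge>2. \<beta>s t = \<beta>) \<and> \<tau> 1 = 0 \<and> \<tau> 2 = \<mu> \<and>
     ereal (\<eta> 2) =
       min (ereal ((1 - \<beta>) * \<eta> 1)) (ereal \<mu> / ereal (4 * (local_norm A y 1)\<^sup>2)) \<and>
     (\<forall>t\<ge>3.
        ereal (\<eta> t) =
          min (ereal (4 / 3 * \<eta> (t - 1)))
            (min (ereal ((\<tau> (t - 2) + \<mu>) / \<tau> (t - 1) * \<eta> (t - 1)))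
               (ereal (\<tau> (t - 1)) / ereal (4 * (local_norm A y (t - 1))\<^sup>2))) \<and>
        \<tau> t = \<tau> (t - 1) + \<mu> / 2 *
          (\<alpha> + (1 - \<alpha>) * \<eta> t * (4 * (local_norm A y (t - 1))\<^sup>2 / \<tau> (t - 1))))"

definition weighted_avg :: "(nat \<Rightarrow> real) \<Rightarrow> (nat \<Rightarrow> 'a::real_vector) \<Rightarrow> nat \<Rightarrow> 'a" where
  "weighted_avg \<eta> v k =
     (1 / (\<Sum>t=1..k. \<eta> (t + 1))) *\<^sub>R (\<Sum>t=1..k. \<eta> (t + 1) *\<^sub>R v t)"

definition ytilde ::
  "real \<Rightarrow> (nat \<Rightarrow> real) \<Rightarrow> (nat \<Rightarrow> real) \<Rightarrow> (nat \<Rightarrow> real^'m) \<Rightarrow> nat \<Rightarrow> real^'m" where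
  "ytilde \<mu> \<eta> \<tau> y k =
     (1 / (\<mu> * (\<Sum>t=1..k. \<eta> (t + 1)))) *\<^sub>R
       ((\<Sum>t=1..k-1. (\<eta> (t + 1) * (\<mu> + \<tau> t) - \<eta> (t + 2) * \<tau> (t + 1)) *\<^sub>R y t)
        + (\<eta> (k + 1) * (\<mu> + \<tau> k)) *\<^sub>R y k)"

definition gap_lhs ::
  "real^'n^'m \<Rightarrow> (real^'n \<Rightarrow> real) \<Rightarrow> (real^'m \<Rightarrow> real) \<Rightarrow> real \<Rightarrow> (nat \<Rightarrow> real) \<Rightarrow> (nat \<Rightarrow> real)
    \<Rightarrow> real^'m \<Rightarrow> (nat \<Rightarrow> real^'n) \<Rightarrow> (nat \<Rightarrow> real^'m) \<Rightarrow> nat \<Rightarrow> real^'n \<Rightarrow> real^'m \<Rightarrow> real" where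
  "gap_lhs A f g \<mu> \<eta> \<tau> ytil0 x y k u v =
     gap A f g (weighted_avg \<eta> x k, weighted_avg \<eta> y k) (u, v)
     - \<mu> / 2 * (norm (ytil0 - v))\<^sup>2
     + \<mu> / 2 * (norm (ytil0 - weighted_avg \<eta> y k))\<^sup>2
     + \<mu> / 2 * (norm (ytilde \<mu> \<eta> \<tau> y k - v))\<^sup>2"

text \<open>
  This quantity can be negative, and then an upper bound with the factor \<open>rate\<close> below can fail,
  since \<open>rate\<close> is only an upper bound of \<open>1 / (2 * (\<Sum>t=1..k. \<eta> (t + 1)))\<close>. Example:
  \<open>X = [0, \<infinity>)\<close>, \<open>Y = {0}\<close>, \<open>A = 0\<close>, \<open>f u = u\<close>, \<open>g = 0\<close>, \<open>x 0 = 1\<close>,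
  \<open>\<mu> = \<alpha> = 1\<close>, \<open>\<beta> = 1 / 10\<close>, \<open>\<eta> 1 = 10 / 9\<close>, \<open>k = 2\<close>, \<open>u = 100\<close>.
\<close>

definition gap_bracket ::
  "real^'n^'m \<Rightarrow> real \<Rightarrow> real \<Rightarrow> (nat \<Rightarrow> real) \<Rightarrow> (nat \<Rightarrow> real^'n) \<Rightarrow> (nat \<Rightarrow> real^'n)
    \<Rightarrow> (nat \<Rightarrow> real^'m) \<Rightarrow> nat \<Rightarrow> real^'n \<Rightarrow> real" where
  "gap_bracket A \<mu> \<beta> \<eta> x xbar y k u =
     ((norm (x 0 - u))\<^sup>2 - (norm (xbar (k + 1) - u))\<^sup>2) / \<beta>
     + \<eta> 2 * (5 * (local_norm A y 1)\<^sup>2 / (2 * \<mu>) - 1 / \<eta> 1) * (norm (x 1 - x 0))\<^sup>2"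

definition rate :: "real^'n^'m \<Rightarrow> (nat \<Rightarrow> real^'m) \<Rightarrow> real \<Rightarrow> real \<Rightarrow> real \<Rightarrow> real \<Rightarrow> nat \<Rightarrow> real" where
  "rate A y \<mu> \<alpha> \<beta> \<eta>1 k =
     12 * (max_local_norm A y \<mu> \<beta> \<eta>1 k)\<^sup>2
       / (\<mu> * (6 * real k + \<alpha> * real k * (real k - 3)))"

end

theory Submission
  imports Defs
begin

text \<open>
  The argument is an energy estimate. Every iterate minimises a strongly convex function, so comparing
  it with an arbitrary point gains a squared distance (\<open>quadratic_growth_at_arg_min\<close>). Add this
  inequality for \<open>x (t + 1)\<close>, for \<open>y t\<close>, and for \<open>x t\<close> compared with \<open>x (t + 1)\<close>, the
  last one rescaled to step size \<open>\<eta> (t + 1)\<close>. The values \<open>f (x (t + 1))\<close> cancel, the bilinear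
  terms combine to \<open>\<eta> (t + 1)\<close> times the gap at \<open>(x t, y t)\<close>, and three things remain
  (\<open>one_step\<close>): the difference of \<open>|xbar t - u|\<^sup>2 / (2 \<beta>)\<close> between consecutive indices, weighted
  distances from \<open>y t\<close> to \<open>v\<close>, and a residual. The residual contains the coupling
  \<open>\<langle>A\<^sup>T (y t - y (t - 1)), x (t + 1) - x t\<rangle>\<close> and, from the rescaled comparison, a positive multiple of
  \<open>V t = |x (t + 1) - xbar t|\<^sup>2\<close>.

  The residual is nevertheless at most \<open>V (t - 1) / 4 - V t / 4\<close> for \<open>t \<ge> 2\<close> (\<open>residual_le\<close>),
  so it telescopes as well. Each of the three terms in the minimum defining \<open>\<eta> (t + 1)\<close> has its own
  task. The factor \<open>4 / 3\<close>, together with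
  \<open>\<beta> \<le> 1 - sqrt 6 / 3\<close>, limits the multiple of \<open>V t\<close> from the rescaled comparison;
  the local norm bounds the coupling; and the ratio of the \<open>\<tau>\<close> makes the weights of the
  distances \<open>|y t - v|\<^sup>2\<close> nonnegative after summation by parts. In the first step \<open>\<tau> 1 = 0\<close>
  provides no control of \<open>y 1 - y 0\<close>, and strong convexity in \<open>y\<close> is used instead
  (\<open>first_dual_step_le\<close>); this produces the positive \<open>|x 1 - x 0|\<^sup>2\<close> term of the bound.

  Summing over \<open>t\<close> and applying Jensen's inequality to the gap, to \<open>|\<sqdot> - ytil0|\<^sup>2\<close> and to
  \<open>|\<sqdot> - v|\<^sup>2\<close> bounds the gap at the weighted averages by the bracket divided by twice the sum of
  the weights (\<open>gap_lhs_le\<close>). The rate then requires a lower bound for this sum, which follows from the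
  bound on each \<open>\<eta> t\<close> (\<open>eta_lower_bound\<close>), an induction on the step-size recursion. For bounded
  \<open>X\<close> and \<open>Y\<close> the bracket is at most \<open>1 / \<beta> + 5 / 8\<close> times the squared diameter bound, and the
  maximum is attained because the gap is upper semicontinuous in its second argument.
\<close>

section \<open>Convex minimisation\<close>

lemma norm_sq_convex_combination:
  fixes b p q :: "'a::real_inner"
  shows "(norm (b - ((1 - l) *\<^sub>R p + l *\<^sub>R q)))\<^sup>2
    = (1 - l) * (norm (b - p))\<^sup>2 + l * (norm (b - q))\<^sup>2 - l * (1 - l) * (norm (q - p))\<^sup>2"
  by (simp add: power2_norm_eq_inner inner_simps inner_commute algebra_simps)

lemma norm_add_sq_le: "(norm (a + b))\<^sup>2 \<le> 2 * (norm a)\<^sup>2 + 2 * (norm b)\<^sup>2"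
  for a b :: "'a::real_inner"
proof -
  have "2 * (norm a)\<^sup>2 + 2 * (norm b)\<^sup>2 - (norm (a + b))\<^sup>2 = (norm (a - b))\<^sup>2"
    by (simp add: power2_norm_eq_inner inner_simps inner_commute algebra_simps)
  then show ?thesis
    by (smt (verit) zero_le_power2)
qed

text \<open>
  The objective is strongly convex with modulus \<open>c + d\<close>, so it grows quadratically away from its
  minimiser. Comparing \<open>p\<close> with \<open>(1 - l) p + l q\<close>, dividing by \<open>l\<close> and letting
  \<open>l \<rightarrow> 0\<close> gives the growth without any subgradient calculus.
\<close>

lemma quadratic_growth_at_arg_min:
  fixes \<phi> :: "'a::real_inner \<Rightarrow> real"
  assumes S: "convex S" and \<phi>: "convex_on S \<phi>"
    and p: "is_arg_min (\<lambda>w. \<phi> w + c / 2 * (norm (b - w))\<^sup>2 + d / 2 * (norm (e - w))\<^sup>2) (\<lambda>w. w \<in> S) p"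
    and q: "q \<in> S"
  shows "\<phi> p + c / 2 * (norm (b - p))\<^sup>2 + d / 2 * (norm (e - p))\<^sup>2 + (c + d) / 2 * (norm (q - p))\<^sup>2
    \<le> \<phi> q + c / 2 * (norm (b - q))\<^sup>2 + d / 2 * (norm (e - q))\<^sup>2"
proof -
  define \<psi> where "\<psi> w = \<phi> w + c / 2 * (norm (b - w))\<^sup>2 + d / 2 * (norm (e - w))\<^sup>2" for w
  define M where "M = (c + d) / 2 * (norm (q - p))\<^sup>2"
  have min: "\<psi> p \<le> \<psi> w" if "w \<in> S" for w
    using p that unfolding is_arg_min_linorder \<psi>_def by auto
  have pS: "p \<in> S" using p by (simp add: is_arg_min_def)
  have l: "\<psi> p + (1 - l) * M \<le> \<psi> q" if "0 < l" "l < 1" for l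
  proof -
    have "(1 - l) *\<^sub>R p + l *\<^sub>R q \<in> S"
      using S pS q that by (simp add: convex_alt)
    then have "\<psi> p \<le> \<psi> ((1 - l) *\<^sub>R p + l *\<^sub>R q)" by (rule min)
    also have "\<dots> \<le> (1 - l) * \<psi> p + l * \<psi> q - l * (1 - l) * M"
      using convex_onD[OF \<phi>, of l p q] that pS q
      unfolding \<psi>_def M_def norm_sq_convex_combination by (simp add: field_simps)
    finally have "l * (\<psi> p + (1 - l) * M) \<le> l * \<psi> q" by (simp add: algebra_simps)
    with that show ?thesis by simp
  qed
  have "((\<lambda>l. \<psi> p + (1 - l) * M) \<longlongrightarrow> \<psi> p + (1 - 0) * M) (at_right 0)"
    by (intro tendsto_intros)
  moreover have "eventually (\<lambda>l. \<psi> p + (1 - l) * M \<le> \<psi> q) (at_right 0)"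
    using l by (auto intro!: eventually_at_rightI[of 0 1])
  ultimately have "\<psi> p + (1 - 0) * M \<le> \<psi> q"
    by (intro tendsto_upperbound) auto
  then show ?thesis by (simp add: \<psi>_def M_def)
qed

text \<open>
  If no point were minimal, the relatively open sets \<open>{u. h u > h s}\<close> would cover \<open>S\<close>;
  among the centres of a finite subcover the one with the least value is not covered.
\<close>

lemma lsc_on_compact_attains_min:
  assumes S: "compact S" "S \<noteq> {}" and h: "lsc_on S h"
  shows "\<exists>s\<in>S. \<forall>u\<in>S. h s \<le> h u"
proof (rule ccontr)
  assume no_min: "\<not> ?thesis"
  have "\<exists>U. open U \<and> u \<in> U \<and> (\<exists>s\<in>S. \<forall>w\<in>U \<inter> S. h s < h w)" if u: "u \<in> S" for u
  proof -
    obtain s where s: "s \<in> S" "h s < h u" using no_min u by (auto simp: not_le)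
    with h u have "eventually (\<lambda>w. h s < h w) (at u within S)" by (auto simp: lsc_on_def)
    then obtain U where "open U" "u \<in> U" "\<forall>w\<in>U. w \<noteq> u \<longrightarrow> w \<in> S \<longrightarrow> h s < h w"
      unfolding eventually_at_topological by blast
    with s show ?thesis by (metis IntE)
  qed
  then obtain U c where U: "\<And>u. u \<in> S \<Longrightarrow> open (U u) \<and> u \<in> U u"
    and c: "\<And>u. u \<in> S \<Longrightarrow> c u \<in> S \<and> (\<forall>w\<in>U u \<inter> S. h (c u) < h w)"
    by metis
  obtain F where F: "F \<subseteq> S" "finite F" "S \<subseteq> (\<Union>u\<in>F. U u)"
    using compactE_image[OF S(1), of S U] U by blast
  have "F \<noteq> {}" using F S by auto
  then obtain m where m: "m \<in> F" "\<And>u. u \<in> F \<Longrightarrow> h (c m) \<le> h (c u)"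
    using ex_min_if_finite[of "(\<lambda>u. h (c u)) ` F"] F(2) by (fastforce simp: not_less)
  have "c m \<in> S" using c m F by blast
  then obtain u where "u \<in> F" "c m \<in> U u" using F by blast
  with c F m \<open>c m \<in> S\<close> show False by (meson IntI not_le subsetD)
qed

lemma lsc_on_add_continuous:
  fixes h k :: "'a::topological_space \<Rightarrow> real"
  assumes h: "lsc_on S h" and k: "continuous_on S k"
  shows "lsc_on S (\<lambda>u. h u + k u)"
  unfolding lsc_on_def
proof (intro ballI allI impI)
  fix u c assume u: "u \<in> S" and c: "c < h u + k u"
  define e where "e = (h u + k u - c) / 2"
  have "e > 0" using c by (simp add: e_def)
  have "eventually (\<lambda>w. h u - e < h w) (at u within S)"
    using h u \<open>e > 0\<close> by (simp add: lsc_on_def)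
  moreover have "eventually (\<lambda>w. k u - e < k w) (at u within S)"
    using k u \<open>e > 0\<close> by (intro order_tendstoD(1)[of k "k u"]) (auto simp: continuous_on_def)
  ultimately show "eventually (\<lambda>w. c < h w + k w) (at u within S)"
    by eventually_elim (simp add: e_def field_simps)
qed

lemma weighted_mean_norm_sq_le:
  fixes v :: "'b \<Rightarrow> 'a::real_inner"
  assumes w: "\<And>i. i \<in> I \<Longrightarrow> 0 \<le> w i" and W: "sum w I = W" "W > 0"
  shows "W * (norm ((1 / W) *\<^sub>R (\<Sum>i\<in>I. w i *\<^sub>R v i) - p))\<^sup>2 \<le> (\<Sum>i\<in>I. w i * (norm (v i - p))\<^sup>2)"
proof -
  define m where "m = (1 / W) *\<^sub>R (\<Sum>i\<in>I. w i *\<^sub>R v i)"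
  have "W *\<^sub>R m = (\<Sum>i\<in>I. w i *\<^sub>R v i)" using W by (simp add: m_def)
  then have centred: "(\<Sum>i\<in>I. w i *\<^sub>R (v i - m)) = 0"
    using W(1) by (simp add: scaleR_diff_right sum_subtractf scaleR_sum_left[symmetric])
  have "W * (norm (m - p))\<^sup>2
      = (\<Sum>i\<in>I. w i * (norm (m - p))\<^sup>2) + 2 * ((\<Sum>i\<in>I. w i *\<^sub>R (v i - m)) \<bullet> (m - p))"
    using W(1) centred by (simp add: sum_distrib_right[symmetric])
  also have "\<dots> = (\<Sum>i\<in>I. w i * ((norm (m - p))\<^sup>2 + 2 * ((v i - m) \<bullet> (m - p))))"
    unfolding distrib_left sum.distrib inner_sum_left sum_distrib_left by (simp add: mult.left_commute)
  also have "\<dots> \<le> (\<Sum>i\<in>I. w i * (norm (v i - p))\<^sup>2)"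
  proof (intro sum_mono mult_left_mono w)
    fix i
    have "(norm (v i - p))\<^sup>2 - ((norm (m - p))\<^sup>2 + 2 * ((v i - m) \<bullet> (m - p))) = (norm (v i - m))\<^sup>2"
      by (simp add: power2_norm_eq_inner inner_simps inner_commute algebra_simps)
    then show "(norm (m - p))\<^sup>2 + 2 * ((v i - m) \<bullet> (m - p)) \<le> (norm (v i - p))\<^sup>2"
      by (smt (verit) zero_le_power2)
  qed
  finally show ?thesis by (simp add: m_def)
qed

section \<open>Step sizes\<close>

text \<open>
  Rewriting by this rule and its strict version turns the step-size recursion, which lives in
  \<^typ>\<open>ereal\<close>, into real inequalities that cover the case \<open>b = 0\<close> uniformly.
\<close>

lemma ereal_le_divide_iff:
  assumes "0 < a" "0 \<le> b"
  shows "ereal c \<le> ereal a / ereal b \<longleftrightarrow> c * b \<le> a"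
  using assms by (cases "b = 0") (auto simp: divide_ereal_def field_simps)

lemma ereal_less_divide_iff:
  assumes "0 < a" "0 \<le> b"
  shows "ereal c < ereal a / ereal b \<longleftrightarrow> c * b < a"
  using assms by (cases "b = 0") (auto simp: divide_ereal_def field_simps)

locale ac_pdhg_run =
  fixes X :: "(real^'n) set" and Y :: "(real^'m) set" and A :: "real^'n^'m"
    and f :: "real^'n \<Rightarrow> real" and g :: "real^'m \<Rightarrow> real"
    and \<mu> \<alpha> \<beta> :: real and \<beta>s \<eta> \<tau> :: "nat \<Rightarrow> real"
    and ytil0 :: "real^'m" and x xbar :: "nat \<Rightarrow> real^'n" and y :: "nat \<Rightarrow> real^'m"
  assumes convex_X: "convex X" and convex_Y: "convex Y"
    and convex_f: "convex_on X f" and convex_g: "convex_on Y g"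
    and \<mu>_pos: "0 < \<mu>" and \<alpha>_pos: "0 < \<alpha>" and \<alpha>_le: "\<alpha> \<le> 1"
    and \<beta>_pos: "0 < \<beta>" and \<beta>_le: "\<beta> \<le> 1 - sqrt 6 / 3"
    and run: "ac_pdhg X Y A f g \<mu> \<beta>s \<eta> \<tau> ytil0 x xbar y"
    and steps: "ac_pdhg_steps A y \<mu> \<alpha> \<beta> \<beta>s \<eta> \<tau>"
begin

abbreviation "L \<equiv> local_norm A y"

abbreviation "Lmax \<equiv> max_local_norm A y \<mu> \<beta> (\<eta> 1)"

lemma eta_1_pos: "0 < \<eta> 1" and \<beta>s_1: "\<beta>s 1 = 0" and \<beta>s_eq: "2 \<le> t \<Longrightarrow> \<beta>s t = \<beta>"
  and tau_1: "\<tau> 1 = 0" and tau_2: "\<tau> 2 = \<mu>"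
  using steps unfolding ac_pdhg_steps_def by blast+

lemma eta_2_eq: "ereal (\<eta> 2)
    = min (ereal ((1 - \<beta>) * \<eta> 1)) (ereal \<mu> / ereal (4 * (L 1)\<^sup>2))"
  using steps unfolding ac_pdhg_steps_def by blast

lemma one_minus_\<beta>_sq_ge: "2 / 3 \<le> (1 - \<beta>)\<^sup>2"
proof -
  have "(sqrt 6 / 3)\<^sup>2 \<le> (1 - \<beta>)\<^sup>2"
    using \<beta>_le by (intro power_mono) auto
  then show ?thesis by (simp add: power_divide)
qed

lemma \<beta>_lt_1: "\<beta> < 1"
proof -
  have "0 < sqrt (6::real)" by simp
  with \<beta>_le show ?thesis by linarith
qed

lemma le_eta_2_iff: "c \<le> \<eta> 2 \<longleftrightarrow> c \<le> (1 - \<beta>) * \<eta> 1 \<and> c * (4 * (L 1)\<^sup>2) \<le> \<mu>"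
proof -
  have "c \<le> \<eta> 2 \<longleftrightarrow> ereal c \<le> ereal (\<eta> 2)" by simp
  also have "\<dots> \<longleftrightarrow> c \<le> (1 - \<beta>) * \<eta> 1 \<and> ereal c \<le> ereal \<mu> / ereal (4 * (L 1)\<^sup>2)"
    unfolding eta_2_eq by simp
  finally show ?thesis by (subst (asm) ereal_le_divide_iff) (use \<mu>_pos in auto)
qed

lemma eta_2_pos: "0 < \<eta> 2"
proof -
  have "ereal 0 < ereal \<mu> / ereal (4 * (L 1)\<^sup>2)"
    by (subst ereal_less_divide_iff) (use \<mu>_pos in auto)
  then have "ereal 0 < ereal (\<eta> 2)"
    unfolding eta_2_eq using eta_1_pos \<beta>_lt_1 by simp
  then show ?thesis by simp
qed

lemma eta_rec:
  assumes "2 \<le> t"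
  shows "ereal (\<eta> (Suc t)) = min (ereal (4 / 3 * \<eta> t))
    (min (ereal ((\<tau> (t - 1) + \<mu>) / \<tau> t * \<eta> t)) (ereal (\<tau> t) / ereal (4 * (L t)\<^sup>2)))"
proof -
  have "3 \<le> Suc t" using assms by simp
  moreover have "Suc t - 2 = t - 1" using assms by simp
  ultimately show ?thesis using steps unfolding ac_pdhg_steps_def by (metis diff_Suc_1)
qed

lemma tau_rec:
  assumes "2 \<le> t"
  shows "\<tau> (Suc t) = \<tau> t + \<mu> / 2 * (\<alpha> + (1 - \<alpha>) * (\<eta> (Suc t) * (4 * (L t)\<^sup>2) / \<tau> t))"
proof -
  have "3 \<le> Suc t" using assms by simp
  with steps have "\<tau> (Suc t) = \<tau> (Suc t - 1) + \<mu> / 2 *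
          (\<alpha> + (1 - \<alpha>) * \<eta> (Suc t) * (4 * (L (Suc t - 1))\<^sup>2 / \<tau> (Suc t - 1)))"
    unfolding ac_pdhg_steps_def by blast
  then show ?thesis by (simp add: mult.assoc)
qed

lemma eta_tau_pos: "2 \<le> t \<Longrightarrow> 0 < \<eta> t \<and> 0 < \<tau> t"
proof (induction t rule: nat_less_induct)
  case (1 t)
  show ?case
  proof (cases "t = 2")
    case True
    then show ?thesis using eta_2_pos tau_2 \<mu>_pos by simp
  next
    case False
    define s where "s = t - 1"
    have t: "t = Suc s" "2 \<le> s" using 1 False by (auto simp: s_def)
    have s: "0 < \<eta> s" "0 < \<tau> s" using 1 t by auto
    have "0 \<le> \<tau> (s - 1)"
      using 1 t tau_1 by (cases "s = 2") (auto simp: order_less_imp_le)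
    then have "0 < (\<tau> (s - 1) + \<mu>) / \<tau> s * \<eta> s" using s \<mu>_pos by simp
    moreover have "ereal 0 < ereal (\<tau> s) / ereal (4 * (L s)\<^sup>2)"
      by (subst ereal_less_divide_iff) (use s in auto)
    ultimately have "ereal 0 < ereal (\<eta> t)"
      using s by (simp add: t eta_rec)
    then have \<eta>t: "0 < \<eta> t" by simp
    then have "0 \<le> \<eta> (Suc s) * (4 * (L s)\<^sup>2) / \<tau> s" using s t by simp
    then have "0 \<le> \<mu> / 2 * (\<alpha> + (1 - \<alpha>) * (\<eta> (Suc s) * (4 * (L s)\<^sup>2) / \<tau> s))"
      using \<mu>_pos \<alpha>_pos \<alpha>_le by (intro mult_nonneg_nonneg add_nonneg_nonneg) auto
    then have "0 < \<tau> t" using s unfolding t(1) tau_rec[OF t(2)] by linarith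
    with \<eta>t show ?thesis by simp
  qed
qed

lemma eta_pos: "1 \<le> t \<Longrightarrow> 0 < \<eta> t"
  using eta_1_pos eta_tau_pos[of t] by (cases "t = 1") auto

lemma tau_pos: "2 \<le> t \<Longrightarrow> 0 < \<tau> t"
  using eta_tau_pos by blast

lemma tau_nonneg: "1 \<le> t \<Longrightarrow> 0 \<le> \<tau> t"
  using tau_1 tau_pos[of t] by (cases "t = 1") auto

lemma le_eta_Suc_iff:
  assumes "2 \<le> t"
  shows "c \<le> \<eta> (Suc t) \<longleftrightarrow>
    c \<le> 4 / 3 * \<eta> t \<and> c \<le> (\<tau> (t - 1) + \<mu>) / \<tau> t * \<eta> t \<and> c * (4 * (L t)\<^sup>2) \<le> \<tau> t"
proof -
  have "c \<le> \<eta> (Suc t) \<longleftrightarrow> ereal c \<le> ereal (\<eta> (Suc t))" by simp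
  also have "\<dots> \<longleftrightarrow> c \<le> 4 / 3 * \<eta> t \<and> c \<le> (\<tau> (t - 1) + \<mu>) / \<tau> t * \<eta> t
      \<and> ereal c \<le> ereal (\<tau> t) / ereal (4 * (L t)\<^sup>2)"
    unfolding eta_rec[OF assms] by simp
  finally show ?thesis by (subst (asm) ereal_le_divide_iff) (use tau_pos assms in auto)
qed

lemmas eta_2_le = le_eta_2_iff[of "\<eta> 2", simplified]

lemma eta_Suc_le:
  assumes "2 \<le> t"
  shows "\<eta> (Suc t) \<le> 4 / 3 * \<eta> t"
    and "\<eta> (Suc t) * \<tau> t \<le> \<eta> t * (\<mu> + \<tau> (t - 1))"
    and "\<eta> (Suc t) * (4 * (L t)\<^sup>2) \<le> \<tau> t"
  using le_eta_Suc_iff[OF assms, of "\<eta> (Suc t)"] tau_pos[OF assms] by (auto simp: field_simps)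

text \<open>
  These are the weights in \<^const>\<open>ytilde\<close>; the second term of the minimum is designed to keep them
  nonnegative, so that Jensen's inequality applies.
\<close>

lemma eta_tau_weight_nonneg:
  assumes "1 \<le> t"
  shows "0 \<le> \<eta> (t + 1) * (\<mu> + \<tau> t) - \<eta> (t + 2) * \<tau> (t + 1)"
proof -
  have "2 \<le> Suc t" using assms by simp
  then show ?thesis
    using eta_Suc_le(2)[of "Suc t"] by simp
qed

text \<open>
  The increment lies between \<open>\<alpha> \<mu> / 2\<close> and \<open>\<mu> / 2\<close> because the ratio weighted by \<open>1 - \<alpha>\<close> in
  the recursion is at most \<open>1\<close>, by the local-norm restriction on \<open>\<eta> (t + 1)\<close>.
\<close>

lemma tau_increment:
  assumes t: "2 \<le> t"
  shows "\<tau> t + \<mu> / 2 * \<alpha> \<le> \<tau> (Suc t)" "\<tau> (Suc t) \<le> \<tau> t + \<mu> / 2"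
proof -
  define r where "r = \<eta> (Suc t) * (4 * (L t)\<^sup>2) / \<tau> t"
  have r: "0 \<le> r" "r \<le> 1"
    using eta_Suc_le(3)[OF t] tau_pos[OF t] eta_pos[of "Suc t"] by (auto simp: r_def)
  then have "(1 - \<alpha>) * r \<le> (1 - \<alpha>) * 1" "0 \<le> (1 - \<alpha>) * r"
    using \<alpha>_le by (auto intro!: mult_left_mono simp del: mult_1_right)
  then have "\<alpha> \<le> \<alpha> + (1 - \<alpha>) * r" "\<alpha> + (1 - \<alpha>) * r \<le> 1" by simp_all
  then have "\<mu> / 2 * \<alpha> \<le> \<mu> / 2 * (\<alpha> + (1 - \<alpha>) * r)" "\<mu> / 2 * (\<alpha> + (1 - \<alpha>) * r) \<le> \<mu> / 2 * 1"
    using \<mu>_pos mult_left_mono[of _ _ "\<mu> / 2"] by (meson half_gt_zero less_imp_le)+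
  then show "\<tau> t + \<mu> / 2 * \<alpha> \<le> \<tau> (Suc t)" "\<tau> (Suc t) \<le> \<tau> t + \<mu> / 2"
    by (simp_all add: tau_rec[OF t] r_def)
qed

lemma tau_bounds: "2 \<le> t \<Longrightarrow> \<mu> * (2 + \<alpha> * (real t - 2)) / 2 \<le> \<tau> t \<and> \<tau> t \<le> \<mu> * real t / 2"
proof (induction t rule: nat_induct_at_least)
  case base
  show ?case using tau_2 by simp
next
  case (Suc t)
  then show ?case using tau_increment[OF Suc(1)] by (simp add: algebra_simps add_divide_distrib)
qed

lemma Lmax_facts:
  shows Lmax_pos: "0 < Lmax t"
    and Lmax_mono: "s \<le> t \<Longrightarrow> Lmax s \<le> Lmax t"
    and L_le_Lmax: "1 \<le> s \<Longrightarrow> s \<le> t \<Longrightarrow> (L s)\<^sup>2 \<le> (Lmax t)\<^sup>2"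
    and eta_1_ge: "\<mu> / (4 * (1 - \<beta>) * \<eta> 1) \<le> (Lmax t)\<^sup>2"
proof -
  define q where "q = \<mu> / (4 * (1 - \<beta>) * \<eta> 1)"
  have q: "0 < q" using \<mu>_pos \<beta>_lt_1 eta_1_pos by (simp add: q_def)
  have "sqrt q \<le> Lmax t" unfolding max_local_norm_def q_def by (rule Max_ge) auto
  with real_sqrt_gt_zero[OF q] show "0 < Lmax t" by linarith
  show "\<mu> / (4 * (1 - \<beta>) * \<eta> 1) \<le> (Lmax t)\<^sup>2"
    using sqrt_le_D[OF \<open>sqrt q \<le> Lmax t\<close>] by (simp add: q_def)
  show "Lmax s \<le> Lmax t" if "s \<le> t"
    using that unfolding max_local_norm_def by (intro Max_mono insert_mono image_mono) auto
  show "(L s)\<^sup>2 \<le> (Lmax t)\<^sup>2" if "1 \<le> s" "s \<le> t"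
  proof (rule power_mono)
    show "L s \<le> Lmax t" using that unfolding max_local_norm_def by (intro Max_ge) auto
  qed (simp add: local_norm_def)
qed

lemma eta_2_ge: "\<mu> / (4 * (Lmax 1)\<^sup>2) \<le> \<eta> 2"
proof -
  define M where "M = (Lmax 1)\<^sup>2"
  have M: "0 < M" "\<mu> / (4 * (1 - \<beta>) * \<eta> 1) \<le> M" "(L 1)\<^sup>2 \<le> M"
    using Lmax_pos[of 1] eta_1_ge L_le_Lmax[of 1 1] by (auto simp: M_def)
  then have "\<mu> / (4 * M) \<le> \<eta> 2"
    unfolding le_eta_2_iff using \<mu>_pos \<beta>_lt_1 eta_1_pos by (auto simp: field_simps)
  then show ?thesis by (simp add: M_def)
qed

text \<open>
  Each of the three terms of the minimum preserves the bound. The local-norm term does because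
  \<open>\<tau>\<close> grows at least linearly with slope \<open>\<alpha> \<mu> / 2\<close>. For the second term, \<open>\<tau>\<close> grows by
  at most \<open>\<mu> / 2\<close> per step, so \<open>\<tau> t \<le> t \<mu> / 2\<close> and the factor
  \<open>(\<tau> (t - 1) + \<mu>) / \<tau> t\<close> is at least \<open>(t + 1) / t\<close>, which is enough for a bound linear in
  \<open>t\<close> with slope \<open>\<alpha> \<le> 1\<close>. The same slope condition makes the factor \<open>4 / 3\<close> harmless.
\<close>

lemma eta_lower_bound:
  "2 \<le> t \<Longrightarrow> (3 + \<alpha> * (real t - 3)) * \<mu> / (12 * (Lmax (t - 1))\<^sup>2) \<le> \<eta> t"
proof (induction t rule: nat_induct_at_least)
  case base
  have "(3 - \<alpha>) * \<mu> / (12 * (Lmax 1)\<^sup>2) \<le> 3 * \<mu> / (12 * (Lmax 1)\<^sup>2)"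
    using \<mu>_pos \<alpha>_pos by (intro divide_right_mono mult_right_mono) auto
  with eta_2_ge show ?case by simp
next
  case (Suc t)
  define M where "M = (Lmax t)\<^sup>2"
  define K where "K = \<mu> / (12 * M)"
  define a where "a = 3 + \<alpha> * (real t - 3)"
  have M: "0 < M" "(L t)\<^sup>2 \<le> M"
    using Lmax_pos[of t] L_le_Lmax[of t t] Suc(1) by (auto simp: M_def)
  have K: "0 < K" using M \<mu>_pos by (simp add: K_def)
  have "(Lmax (t - 1))\<^sup>2 \<le> M"
    unfolding M_def by (intro power_mono Lmax_mono less_imp_le[OF Lmax_pos]) simp
  have t: "2 \<le> real t" using Suc(1) by simp
  have "\<alpha> * (3 - real t) \<le> 1"
    using \<alpha>_le \<alpha>_pos t by (cases "real t \<le> 3") (auto intro: mult_le_one order_trans[OF mult_nonneg_nonpos])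
  then have a: "2 \<le> a" by (simp add: a_def algebra_simps)
  have IH: "a * K \<le> \<eta> t"
  proof -
    have "a * K \<le> a * \<mu> / (12 * (Lmax (t - 1))\<^sup>2)"
      using \<open>(Lmax (t - 1))\<^sup>2 \<le> M\<close> a \<mu>_pos Lmax_pos[of "t - 1"]
      unfolding K_def times_divide_eq_right
      by (intro divide_left_mono mult_left_mono mult_pos_pos) (use M in auto)
    with Suc show ?thesis by (simp add: a_def)
  qed
  have norm_term: "(a + \<alpha>) * K * (4 * (L t)\<^sup>2) \<le> \<tau> t"
  proof -
    have "(a + \<alpha>) * K * (4 * (L t)\<^sup>2) \<le> (a + \<alpha>) * K * (4 * M)"
      using M K a \<alpha>_pos by (intro mult_left_mono) auto
    also have "\<dots> = \<mu> * (2 * (a + \<alpha>) / 3) / 2"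
      using M by (simp add: K_def)
    also have "\<dots> \<le> \<mu> * (2 + \<alpha> * (real t - 2)) / 2"
      using \<mu>_pos \<alpha>_pos t by (simp add: a_def field_simps)
    finally show ?thesis using tau_bounds[OF Suc(1)] by linarith
  qed
  have "(a + \<alpha>) * K \<le> \<eta> (Suc t)"
  proof (cases "t = 2")
    case True
    \<comment> \<open>Here \<open>\<eta> 2\<close> satisfies the bound \<open>\<mu> / (4 M)\<close>, better than the induction hypothesis,
      and \<open>(\<tau> 1 + \<mu>) / \<tau> 2 = 1\<close> passes it on unchanged.\<close>
    have "a + \<alpha> = 3" using True by (simp add: a_def)
    have "(Lmax 1)\<^sup>2 \<le> M" "0 < Lmax 1"
      using \<open>(Lmax (t - 1))\<^sup>2 \<le> M\<close> Lmax_pos True by auto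
    have "\<mu> / (4 * M) \<le> \<mu> / (4 * (Lmax 1)\<^sup>2)"
      using \<open>(Lmax 1)\<^sup>2 \<le> M\<close> \<open>0 < Lmax 1\<close> \<mu>_pos M by (intro divide_left_mono) auto
    then have "3 * K \<le> \<eta> 2" using eta_2_ge by (simp add: K_def)
    then show ?thesis
      unfolding le_eta_Suc_iff[OF Suc(1)]
      using norm_term \<open>a + \<alpha> = 3\<close> K True tau_1 tau_2 \<mu>_pos by simp
  next
    case False
    then have t3: "3 \<le> real t" using Suc(1) by simp
    have "(a + \<alpha>) \<le> 4 / 3 * a"
    proof -
      have "3 \<le> a" using \<alpha>_pos t3 by (simp add: a_def)
      with \<alpha>_le show ?thesis by linarith
    qed
    then have c1: "(a + \<alpha>) * K \<le> 4 / 3 * \<eta> t"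
      using IH mult_right_mono[of "a + \<alpha>" "4 / 3 * a" K] K by linarith
    have \<tau>t: "0 < \<tau> t" using tau_pos[OF Suc(1)] .
    have "\<tau> t \<le> \<tau> (t - 1) + \<mu> / 2"
      using tau_increment(2)[of "t - 1"] False Suc(1) by simp
    then have "\<tau> t * real t \<le> (\<tau> (t - 1) + \<mu> / 2) * real t" by (intro mult_right_mono) auto
    then have "(real t + 1) / real t \<le> (\<tau> (t - 1) + \<mu>) / \<tau> t"
      using tau_bounds[OF Suc(1)] \<tau>t t3 by (simp add: field_simps)
    moreover have "a + \<alpha> \<le> (real t + 1) / real t * a"
      using \<alpha>_le t3 by (simp add: a_def field_simps)
    ultimately have "a + \<alpha> \<le> (\<tau> (t - 1) + \<mu>) / \<tau> t * a"
      using a by (meson mult_right_mono order_trans less_imp_le zero_less_numeral order_less_le_trans)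
    then have "(a + \<alpha>) * K \<le> (\<tau> (t - 1) + \<mu>) / \<tau> t * (a * K)"
      using mult_right_mono[OF _ less_imp_le[OF K]] unfolding mult.assoc[symmetric] by blast
    also have "\<dots> \<le> (\<tau> (t - 1) + \<mu>) / \<tau> t * \<eta> t"
      using IH \<tau>t tau_nonneg[of "t - 1"] \<mu>_pos Suc(1) by (intro mult_left_mono divide_nonneg_pos) auto
    finally show ?thesis
      unfolding le_eta_Suc_iff[OF Suc(1)] using c1 norm_term by simp
  qed
  then show ?case by (simp add: a_def K_def M_def algebra_simps)
qed

end

section \<open>One step of the method\<close>

context ac_pdhg_run
begin

lemma inner_transpose: "(transpose A *v w) \<bullet> u = (A *v u) \<bullet> w"
  by (metis dot_lmul_matrix inner_commute transpose_matrix_vector)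

lemma x_in: "x t \<in> X"
  and y_in: "y t \<in> Y"
  using run unfolding ac_pdhg_def is_arg_min_def by (cases "t = 0"; simp)+

lemma xbar_0: "xbar 0 = x 0"
  using run unfolding ac_pdhg_def by blast

lemma xbar_eq: "1 \<le> t \<Longrightarrow> xbar t = (1 - \<beta>s t) *\<^sub>R xbar (t - 1) + \<beta>s t *\<^sub>R x t"
  using run unfolding ac_pdhg_def by blast

lemma xbar_1: "xbar 1 = x 0"
  using xbar_eq[of 1] \<beta>s_1 xbar_0 by simp

text \<open>This holds also for \<open>y t = y (t - 1)\<close>, when both sides vanish.\<close>

lemma norm_transpose_diff:
  "norm (transpose A *v (y t - y (t - 1))) = L t * norm (y t - y (t - 1))"
  by (simp add: local_norm_def)

lemma x_step:
  assumes t: "1 \<le> t" and u: "u \<in> X"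
  shows "\<eta> t * ((transpose A *v y (t - 1)) \<bullet> (x t - u) + f (x t) - f u)
    \<le> 1 / 2 * ((norm (xbar (t - 1) - u))\<^sup>2 - (norm (x t - u))\<^sup>2 - (norm (xbar (t - 1) - x t))\<^sup>2)"
proof -
  define \<phi> where "\<phi> w = \<eta> t * ((transpose A *v y (t - 1)) \<bullet> w + f w)" for w
  have "convex_on X \<phi>"
    unfolding \<phi>_def using eta_pos[OF t] convex_X
    by (intro convex_on_cmul convex_on_add convex_f) (auto simp: convex_on_def inner_simps)
  moreover have "is_arg_min (\<lambda>w. \<phi> w + 1 / 2 * (norm (xbar (t - 1) - w))\<^sup>2
      + 0 / 2 * (norm (0 - w))\<^sup>2) (\<lambda>w. w \<in> X) (x t)"
    using run t unfolding ac_pdhg_def \<phi>_def by simp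
  ultimately show ?thesis
    using quadratic_growth_at_arg_min[OF convex_X, of \<phi> 1 "xbar (t - 1)" 0 0 "x t" u] u
    by (simp add: \<phi>_def inner_diff_right norm_minus_commute[of u] algebra_simps)
qed

lemma y_step:
  assumes t: "1 \<le> t" and v: "v \<in> Y"
  shows "(A *v x t) \<bullet> (v - y t) + g (y t) - g v
      + \<mu> / 2 * (norm (ytil0 - y t))\<^sup>2 - \<mu> / 2 * (norm (ytil0 - v))\<^sup>2
    \<le> \<tau> t / 2 * (norm (y (t - 1) - v))\<^sup>2 - (\<mu> + \<tau> t) / 2 * (norm (y t - v))\<^sup>2
      - \<tau> t / 2 * (norm (y t - y (t - 1)))\<^sup>2"
proof -
  define \<phi> where "\<phi> w = (- (A *v x t)) \<bullet> w + g w" for w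
  have "convex_on Y \<phi>"
    unfolding \<phi>_def using convex_Y
    by (intro convex_on_add convex_g) (auto simp: convex_on_def inner_simps algebra_simps)
  moreover have "is_arg_min (\<lambda>w. \<phi> w + \<mu> / 2 * (norm (ytil0 - w))\<^sup>2
      + \<tau> t / 2 * (norm (y (t - 1) - w))\<^sup>2) (\<lambda>w. w \<in> Y) (y t)"
    using run t unfolding ac_pdhg_def \<phi>_def by simp
  ultimately show ?thesis
    using quadratic_growth_at_arg_min[OF convex_Y, of \<phi> \<mu> ytil0 "\<tau> t" "y (t - 1)" "y t" v] v
    by (simp add: \<phi>_def inner_diff_right norm_minus_commute[of v] norm_minus_commute[of "y t" "y (t - Suc 0)"])
qed

lemma y_step_0:
  assumes v: "v \<in> Y"
  shows "(A *v x 0) \<bullet> (v - y 0) + g (y 0) - g v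
      + \<mu> / 2 * (norm (ytil0 - y 0))\<^sup>2 - \<mu> / 2 * (norm (ytil0 - v))\<^sup>2
    \<le> - (\<mu> / 2 * (norm (y 0 - v))\<^sup>2)"
proof -
  define \<phi> where "\<phi> w = (- (A *v x 0)) \<bullet> w + g w" for w
  have "convex_on Y \<phi>"
    unfolding \<phi>_def using convex_Y
    by (intro convex_on_add convex_g) (auto simp: convex_on_def inner_simps algebra_simps)
  moreover have "is_arg_min (\<lambda>w. \<phi> w + \<mu> / 2 * (norm (ytil0 - w))\<^sup>2
      + 0 / 2 * (norm (0 - w))\<^sup>2) (\<lambda>w. w \<in> Y) (y 0)"
    using run unfolding ac_pdhg_def \<phi>_def by simp
  ultimately show ?thesis
    using quadratic_growth_at_arg_min[OF convex_Y, of \<phi> \<mu> ytil0 0 0 "y 0" v] v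
    by (simp add: \<phi>_def inner_diff_right norm_minus_commute[of v])
qed

text \<open>
  Without a proximal term linking \<open>y 1\<close> to \<open>y 0\<close>, as \<open>\<tau> 1 = 0\<close>, the dual displacement is
  controlled by the primal one: both points minimise \<open>\<mu>\<close>-strongly convex functions that differ
  only in their linear part.
\<close>

lemma first_dual_step_le: "\<mu> * norm (y 1 - y 0) \<le> L 1 * norm (x 1 - x 0)"
proof -
  define d where "d = norm (y 1 - y 0)"
  have "\<mu> * d\<^sup>2 \<le> (A *v (x 1 - x 0)) \<bullet> (y 1 - y 0)"
    using y_step[of 1 "y 0"] y_step_0[of "y 1"] y_in tau_1
    by (simp add: d_def norm_minus_commute[of "y 0"] inner_simps matrix_vector_mult_diff_distrib)
  also have "\<dots> \<le> (L 1 * d) * norm (x 1 - x 0)"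
    using norm_cauchy_schwarz[of "transpose A *v (y 1 - y 0)" "x 1 - x 0"] norm_transpose_diff[of 1]
    unfolding inner_transpose d_def by simp
  finally have *: "d * (\<mu> * d) \<le> d * (L 1 * norm (x 1 - x 0))"
    by (simp add: power2_eq_square algebra_simps)
  show ?thesis
  proof (cases "d = 0")
    case False
    then have "0 < d" by (simp add: d_def)
    with * show ?thesis by (simp add: d_def)
  qed (simp add: d_def local_norm_def)
qed

text \<open>
  The optimality of \<open>x t\<close>, tested at the next iterate and scaled to step \<open>\<eta> (t + 1)\<close>.
  It is combined with the optimality of \<open>x (t + 1)\<close> to exchange \<open>f (x (t + 1))\<close> for \<open>f (x t)\<close>.
  The definition of \<open>xbar t\<close> makes \<open>x t - xbar (t - 1)\<close> a multiple of \<open>x t - xbar t\<close>.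
\<close>

lemma x_step_at_next:
  assumes t: "1 \<le> t"
  shows "\<eta> (t + 1) * ((transpose A *v y (t - 1)) \<bullet> (x t - x (t + 1)) + f (x t) - f (x (t + 1)))
    \<le> \<eta> (t + 1) / (\<eta> t * (1 - \<beta>s t)) / 2 * ((norm (x (t + 1) - xbar t))\<^sup>2
        - (norm (x t - xbar t))\<^sup>2 - (norm (x (t + 1) - x t))\<^sup>2)"
proof -
  define T where "T = (transpose A *v y (t - 1)) \<bullet> (x t - x (t + 1)) + f (x t) - f (x (t + 1))"
  define B where "B = (norm (x (t + 1) - xbar t))\<^sup>2
        - (norm (x t - xbar t))\<^sup>2 - (norm (x (t + 1) - x t))\<^sup>2"
  have s: "0 < 1 - \<beta>s t" using run t unfolding ac_pdhg_def by simp
  have e: "0 < \<eta> t" "0 < \<eta> (t + 1)" using eta_pos t by auto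
  have diff: "x t - xbar t = (1 - \<beta>s t) *\<^sub>R (x t - xbar (t - 1))"
    using xbar_eq[OF t] by (simp add: algebra_simps)
  have "\<eta> t * T \<le> (x t - xbar (t - 1)) \<bullet> (x (t + 1) - x t)"
    using x_step[OF t x_in[of "t + 1"]]
    by (simp add: T_def power2_norm_eq_inner inner_simps inner_commute algebra_simps)
  then have "(1 - \<beta>s t) * (\<eta> t * T) \<le> (x t - xbar t) \<bullet> (x (t + 1) - x t)"
    unfolding diff inner_scaleR_left using s by (intro mult_left_mono) auto
  also have "\<dots> = B / 2"
    by (simp add: B_def power2_norm_eq_inner inner_simps inner_commute algebra_simps)
  finally have "T \<le> B / 2 / (\<eta> t * (1 - \<beta>s t))"
    using s e by (simp add: pos_le_divide_eq mult.commute mult.left_commute)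
  then have "\<eta> (t + 1) * T \<le> \<eta> (t + 1) * (B / 2 / (\<eta> t * (1 - \<beta>s t)))"
    using e by (intro mult_left_mono) auto
  then show ?thesis by (simp add: T_def B_def field_simps)
qed

text \<open>
  Adding the optimality conditions of \<open>x (t + 1)\<close>, \<open>x t\<close> and \<open>y t\<close> leaves the following terms
  that neither telescope over \<open>t\<close> nor belong to the gap.
\<close>

definition residual :: "nat \<Rightarrow> real" where
  "residual t =
     \<eta> (t + 1) / (\<eta> t * (1 - \<beta>s t)) / 2 * ((norm (x (t + 1) - xbar t))\<^sup>2
        - (norm (x t - xbar t))\<^sup>2 - (norm (x (t + 1) - x t))\<^sup>2)
     - (2 - \<beta>) / 2 * (norm (x (t + 1) - xbar t))\<^sup>2
     + \<eta> (t + 1) * (L t * norm (y t - y (t - 1)) * norm (x (t + 1) - x t)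
        - \<tau> t / 2 * (norm (y t - y (t - 1)))\<^sup>2)"

lemma one_step:
  assumes t: "1 \<le> t" and u: "u \<in> X" and v: "v \<in> Y"
  shows "\<eta> (t + 1) * (gap A f g (x t, y t) (u, v)
        + \<mu> / 2 * (norm (ytil0 - y t))\<^sup>2 - \<mu> / 2 * (norm (ytil0 - v))\<^sup>2)
      + \<eta> (t + 1) / 2 * ((\<mu> + \<tau> t) * (norm (y t - v))\<^sup>2 - \<tau> t * (norm (y (t - 1) - v))\<^sup>2)
    \<le> ((norm (xbar t - u))\<^sup>2 - (norm (xbar (t + 1) - u))\<^sup>2) / (2 * \<beta>) + residual t"
proof -
  define e where "e = \<eta> (t + 1)"
  define dy where "dy = norm (y t - y (t - 1))"
  define dx where "dx = norm (x (t + 1) - x t)"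
  have e: "0 < e" unfolding e_def by (intro eta_pos) simp
  \<comment> \<open>As \<open>xbar (t + 1)\<close> is a convex combination of \<open>xbar t\<close> and \<open>x (t + 1)\<close>, the distance of
      \<open>x (t + 1)\<close> to \<open>u\<close> can be traded for one of \<open>xbar (t + 1)\<close>, which telescopes.\<close>
  have avg: "(norm (xbar (t + 1) - u))\<^sup>2 = (1 - \<beta>) * (norm (xbar t - u))\<^sup>2
      + \<beta> * (norm (x (t + 1) - u))\<^sup>2 - \<beta> * (1 - \<beta>) * (norm (x (t + 1) - xbar t))\<^sup>2"
    using norm_sq_convex_combination[of u \<beta> "xbar t" "x (t + 1)"] xbar_eq[of "t + 1"] \<beta>s_eq[of "t + 1"] t
    by (simp add: norm_minus_commute[of u])
  have x1: "e * ((transpose A *v y t) \<bullet> (x (t + 1) - u) + f (x (t + 1)) - f u)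
      \<le> ((norm (xbar t - u))\<^sup>2 - (norm (xbar (t + 1) - u))\<^sup>2) / (2 * \<beta>)
        - (2 - \<beta>) / 2 * (norm (x (t + 1) - xbar t))\<^sup>2"
  proof -
    have "((norm (xbar t - u))\<^sup>2 - (norm (xbar (t + 1) - u))\<^sup>2) / (2 * \<beta>)
        = 1 / 2 * ((norm (xbar t - u))\<^sup>2 - (norm (x (t + 1) - u))\<^sup>2
            + (1 - \<beta>) * (norm (x (t + 1) - xbar t))\<^sup>2)"
      unfolding avg using \<beta>_pos by (simp add: field_simps)
    moreover have "e * ((transpose A *v y t) \<bullet> (x (t + 1) - u) + f (x (t + 1)) - f u)
      \<le> 1 / 2 * ((norm (xbar t - u))\<^sup>2 - (norm (x (t + 1) - u))\<^sup>2 - (norm (x (t + 1) - xbar t))\<^sup>2)"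
      using x_step[of "t + 1" u] u unfolding e_def norm_minus_commute[of "x (t + 1)" "xbar t"] by simp
    moreover have "(2 - \<beta>) / 2 * (norm (x (t + 1) - xbar t))\<^sup>2
        = 1 / 2 * (norm (x (t + 1) - xbar t))\<^sup>2 + 1 / 2 * ((1 - \<beta>) * (norm (x (t + 1) - xbar t))\<^sup>2)"
      by (simp add: field_simps)
    ultimately show ?thesis unfolding right_diff_distrib distrib_left by linarith
  qed
  have ys: "e * ((A *v x t) \<bullet> (v - y t) + g (y t) - g v
      + \<mu> / 2 * (norm (ytil0 - y t))\<^sup>2 - \<mu> / 2 * (norm (ytil0 - v))\<^sup>2)
    \<le> e * (\<tau> t / 2 * (norm (y (t - 1) - v))\<^sup>2 - (\<mu> + \<tau> t) / 2 * (norm (y t - v))\<^sup>2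
      - \<tau> t / 2 * dy\<^sup>2)"
    unfolding dy_def using y_step[OF t v] e by (intro mult_left_mono) auto
  have "- ((transpose A *v (y t - y (t - 1))) \<bullet> (x (t + 1) - x t)) \<le> L t * dy * dx"
    using norm_cauchy_schwarz[of "- (transpose A *v (y t - y (t - 1)))" "x (t + 1) - x t"]
    unfolding norm_minus_cancel norm_transpose_diff dy_def dx_def by simp
  then have cross: "e * - ((transpose A *v (y t - y (t - 1))) \<bullet> (x (t + 1) - x t)) \<le> e * (L t * dy * dx)"
    using e by (intro mult_left_mono) auto
  \<comment> \<open>The gap is the sum of the left-hand sides of the three optimality conditions, up to the coupling
      \<open>C\<close> caused by \<open>x (t + 1)\<close> being computed with \<open>y t\<close> and \<open>x t\<close> with \<open>y (t - 1)\<close>.\<close>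
  define T1 where "T1 = (transpose A *v y t) \<bullet> (x (t + 1) - u) + f (x (t + 1)) - f u"
  define T2 where "T2 = (transpose A *v y (t - 1)) \<bullet> (x t - x (t + 1)) + f (x t) - f (x (t + 1))"
  define T3 where "T3 = (A *v x t) \<bullet> (v - y t) + g (y t) - g v"
  define C where "C = - ((transpose A *v (y t - y (t - 1))) \<bullet> (x (t + 1) - x t))"
  define N where "N = \<mu> / 2 * (norm (ytil0 - y t))\<^sup>2 - \<mu> / 2 * (norm (ytil0 - v))\<^sup>2"
  define Q where "Q = (\<mu> + \<tau> t) * (norm (y t - v))\<^sup>2 - \<tau> t * (norm (y (t - 1) - v))\<^sup>2"
  have "gap A f g (x t, y t) (u, v) = T1 + T2 + T3 + C"
    unfolding gap_def lagrangian_def T1_def T2_def T3_def C_def inner_transpose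
    by (simp add: matrix_vector_mult_diff_distrib inner_simps)
  then have lhs: "e * (gap A f g (x t, y t) (u, v) + N) + e / 2 * Q
      = e * T1 + e * T2 + e * (T3 + N) + e * C + e / 2 * Q"
    by (simp add: algebra_simps)
  have ys': "e * (T3 + N) \<le> - (e / 2 * Q) - e * (\<tau> t / 2 * dy\<^sup>2)"
    using ys by (simp add: T3_def N_def Q_def field_simps)
  have R: "residual t = \<eta> (t + 1) / (\<eta> t * (1 - \<beta>s t)) / 2 * ((norm (x (t + 1) - xbar t))\<^sup>2
        - (norm (x t - xbar t))\<^sup>2 - (norm (x (t + 1) - x t))\<^sup>2)
     - (2 - \<beta>) / 2 * (norm (x (t + 1) - xbar t))\<^sup>2
     + (e * (L t * dy * dx) - e * (\<tau> t / 2 * dy\<^sup>2))"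
    by (simp add: residual_def e_def dy_def dx_def right_diff_distrib)
  show ?thesis
    using x1 ys' cross x_step_at_next[OF t] lhs
    unfolding T1_def[symmetric] T2_def[symmetric] C_def[symmetric] R e_def[symmetric]
    by (simp only: N_def Q_def add_diff_eq)
qed

text \<open>
  Let \<open>a = x t - xbar t\<close>, \<open>b = x (t + 1) - x t\<close> and \<open>c = \<eta> (t + 1) / (\<eta> t (1 - \<beta>))\<close>, so that
  \<open>a + b = x (t + 1) - xbar t\<close>. The backward comparison contributes
  \<open>c / 2 (|a + b|\<^sup>2 - |a|\<^sup>2 - |b|\<^sup>2) \<le> c / 4 |a + b|\<^sup>2\<close>. Here \<open>c \<le> 2 (1 - \<beta>)\<close>, since
  \<open>\<eta> (t + 1) \<le> 4 / 3 \<eta> t\<close> and \<open>2 / 3 \<le> (1 - \<beta>)\<^sup>2\<close>, which is the origin of the bound on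
  \<open>\<beta>\<close>. Against \<open>- (2 - \<beta>) / 2 |a + b|\<^sup>2\<close> this leaves \<open>- |a + b|\<^sup>2 / 2\<close>. Young's inequality and
  the local-norm restriction bound the coupling by \<open>|b|\<^sup>2 / 8 \<le> |a + b|\<^sup>2 / 4 + |a|\<^sup>2 / 4\<close>,
  and \<open>|a| = (1 - \<beta>) |x t - xbar (t - 1)|\<close> shifts the last term to the previous index.
\<close>

lemma residual_le:
  assumes t: "2 \<le> t"
  shows "residual t \<le> (norm (x t - xbar (t - 1)))\<^sup>2 / 4 - (norm (x (t + 1) - xbar t))\<^sup>2 / 4"
proof -
  define e where "e = \<eta> (t + 1)"
  define dy where "dy = norm (y t - y (t - 1))"
  define V where "V = (norm (x (t + 1) - xbar t))\<^sup>2"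
  define W where "W = (norm (x t - xbar t))\<^sup>2"
  define D where "D = (norm (x (t + 1) - x t))\<^sup>2"
  define c where "c = e / (\<eta> t * (1 - \<beta>))"
  have e: "0 < e" "0 < \<eta> t" "0 < \<tau> t" using t eta_pos tau_pos by (auto simp: e_def)
  have c0: "0 \<le> c" using e \<beta>_lt_1 by (simp add: c_def)
  have c2: "c \<le> 2 * (1 - \<beta>)"
  proof -
    have "e \<le> 4 / 3 * \<eta> t" using eta_Suc_le(1)[OF t] by (simp add: e_def)
    also have "\<dots> \<le> 2 * (1 - \<beta>)\<^sup>2 * \<eta> t"
      using one_minus_\<beta>_sq_ge e by (intro mult_right_mono) auto
    also have "\<dots> = 2 * (1 - \<beta>) * (\<eta> t * (1 - \<beta>))" by (simp add: power2_eq_square)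
    finally show ?thesis
      unfolding c_def using e \<beta>_lt_1 by (subst pos_divide_le_eq) auto
  qed
  have VWD: "V \<le> 2 * W + 2 * D" "D \<le> 2 * V + 2 * W" "0 \<le> V"
    using norm_add_sq_le[of "x t - xbar t" "x (t + 1) - x t"]
      norm_add_sq_le[of "x (t + 1) - xbar t" "xbar t - x t"]
    by (auto simp: V_def W_def D_def norm_minus_commute[of "xbar t"])
  have "W = (1 - \<beta>)\<^sup>2 * (norm (x t - xbar (t - 1)))\<^sup>2"
  proof -
    have "x t - xbar t = (1 - \<beta>) *\<^sub>R (x t - xbar (t - 1))"
      using xbar_eq[of t] \<beta>s_eq[OF t] t by (simp add: algebra_simps)
    then show ?thesis by (simp add: W_def power_mult_distrib)
  qed
  moreover have "(1 - \<beta>)\<^sup>2 \<le> 1" using \<beta>_pos \<beta>_lt_1 by (simp add: power_le_one)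
  ultimately have W: "W \<le> (norm (x t - xbar (t - 1)))\<^sup>2"
    by (simp add: mult_left_le_one_le)
  have coupling: "e * (L t * dy * sqrt D - \<tau> t / 2 * dy\<^sup>2) \<le> D / 8"
  proof -
    have "0 \<le> (L t * sqrt D - \<tau> t * dy)\<^sup>2" by simp
    then have "2 * \<tau> t * (L t * dy * sqrt D - \<tau> t / 2 * dy\<^sup>2) \<le> (L t)\<^sup>2 * D"
      by (simp add: power2_diff power_mult_distrib D_def power2_eq_square algebra_simps)
    then have "e * (2 * \<tau> t * (L t * dy * sqrt D - \<tau> t / 2 * dy\<^sup>2)) \<le> e * ((L t)\<^sup>2 * D)"
      using e by (intro mult_left_mono) auto
    also have "\<dots> = (e * (4 * (L t)\<^sup>2)) * (D / 4)" by simp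
    also have "\<dots> \<le> \<tau> t * (D / 4)"
      using eta_Suc_le(3)[OF t] by (intro mult_right_mono) (auto simp: e_def D_def)
    finally have "\<tau> t * (e * (L t * dy * sqrt D - \<tau> t / 2 * dy\<^sup>2)) \<le> \<tau> t * (D / 8)"
      by (simp only: algebra_simps)
    then show ?thesis using mult_le_cancel_left_pos[OF e(3)] by blast
  qed
  have "c / 2 * (V - W - D) \<le> c / 2 * (V / 2)"
    using c0 VWD by (intro mult_left_mono) auto
  also have "\<dots> \<le> (1 - \<beta>) * (V / 2)"
    using c2 VWD by (intro mult_right_mono) auto
  finally have "c / 2 * (V - W - D) \<le> (1 - \<beta>) * (V / 2)" .
  moreover have "residual t = c / 2 * (V - W - D) - (2 - \<beta>) / 2 * V
      + e * (L t * dy * sqrt D - \<tau> t / 2 * dy\<^sup>2)"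
    using \<beta>s_eq[OF t] by (simp add: residual_def c_def e_def V_def W_def D_def dy_def)
  ultimately have "residual t \<le> W / 4 - V / 4"
    using coupling VWD(2) by (simp add: field_simps)
  with W show ?thesis by (simp add: V_def)
qed

text \<open>
  In the first step \<open>xbar 1 = x 0\<close>, and \<open>first_dual_step_le\<close> turns the coupling into
  \<open>q p d\<close> with \<open>q = \<eta> 2 (L 1)\<^sup>2 / \<mu> \<le> 1 / 4\<close>, \<open>p = |x 1 - x 0|\<close> and
  \<open>d = |x 2 - x 1|\<close>. Splitting \<open>d \<le> p + r\<close> and \<open>p r \<le> p\<^sup>2 / 4 + r\<^sup>2\<close> is what produces the constant
  \<open>5 / 4\<close>, and \<open>q r\<^sup>2 \<le> r\<^sup>2 / 4\<close> still fits into the available \<open>- r\<^sup>2 / 2\<close>.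
\<close>

lemma residual_1_le:
  "residual 1 \<le> \<eta> 2 / 2 * (5 * (L 1)\<^sup>2 / (2 * \<mu>) - 1 / \<eta> 1) * (norm (x 1 - x 0))\<^sup>2
    - (norm (x 2 - xbar 1))\<^sup>2 / 4"
proof -
  define p where "p = norm (x 1 - x 0)"
  define r where "r = norm (x 2 - x 0)"
  define d where "d = norm (x 2 - x 1)"
  define dy where "dy = norm (y 1 - y 0)"
  define c where "c = \<eta> 2 / \<eta> 1"
  define q where "q = \<eta> 2 * (L 1)\<^sup>2 / \<mu>"
  have nonneg: "0 \<le> p" "0 \<le> r" "0 \<le> d" "0 \<le> dy" "0 \<le> c" "0 \<le> q" "0 \<le> L 1"
    using eta_1_pos eta_2_pos \<mu>_pos by (auto simp: p_def r_def d_def dy_def c_def q_def local_norm_def)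
  have c: "c \<le> 1 - \<beta>" and q: "q \<le> 1 / 4"
    using eta_2_le eta_1_pos \<mu>_pos by (auto simp: c_def q_def field_simps)
  have d: "d \<le> p + r"
    using norm_triangle_ineq4[of "x 2 - x 0" "x 1 - x 0"] by (simp add: p_def r_def d_def)
  have "\<eta> 2 * (L 1 * dy * d) \<le> q * p * d"
  proof -
    have "dy \<le> L 1 * p / \<mu>"
      using first_dual_step_le \<mu>_pos by (simp add: dy_def p_def field_simps)
    then have "\<eta> 2 * (L 1 * dy * d) \<le> \<eta> 2 * (L 1 * (L 1 * p / \<mu>) * d)"
      using nonneg eta_2_pos by (intro mult_left_mono mult_right_mono) auto
    then show ?thesis by (simp add: q_def power2_eq_square algebra_simps)
  qed
  also have "\<dots> \<le> q * p * (p + r)"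
    using d nonneg by (intro mult_left_mono) auto
  also have "\<dots> \<le> q * (5 / 4 * p\<^sup>2 + r\<^sup>2)"
  proof -
    have "0 \<le> (p / 2 - r)\<^sup>2" by simp
    then have "p * (p + r) \<le> 5 / 4 * p\<^sup>2 + r\<^sup>2"
      by (simp add: power2_eq_square algebra_simps)
    with nonneg show ?thesis unfolding mult.assoc by (intro mult_left_mono) auto
  qed
  also have "\<dots> \<le> 5 / 4 * q * p\<^sup>2 + r\<^sup>2 / 4"
    using mult_right_mono[OF q, of "r\<^sup>2"] by (simp add: algebra_simps)
  finally have coupling: "\<eta> 2 * (L 1 * dy * d) \<le> 5 / 4 * q * p\<^sup>2 + r\<^sup>2 / 4" .
  have "c / 2 * (r\<^sup>2 - p\<^sup>2 - d\<^sup>2) \<le> c / 2 * (r\<^sup>2 - p\<^sup>2)"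
    using nonneg by (intro mult_left_mono) auto
  moreover have "c * r\<^sup>2 \<le> (1 - \<beta>) * r\<^sup>2" using c by (intro mult_right_mono) auto
  moreover have "residual 1 = c / 2 * (r\<^sup>2 - p\<^sup>2 - d\<^sup>2) - (2 - \<beta>) / 2 * r\<^sup>2 + \<eta> 2 * (L 1 * dy * d)"
    using \<beta>s_1 xbar_1 tau_1
    by (simp add: residual_def c_def p_def r_def d_def dy_def numeral_2_eq_2)
  ultimately have "residual 1 \<le> 5 / 4 * q * p\<^sup>2 - c / 2 * p\<^sup>2 - r\<^sup>2 / 4"
    using coupling by (simp add: algebra_simps add_divide_distrib diff_divide_distrib)
  also have "\<dots> = \<eta> 2 / 2 * (5 * (L 1)\<^sup>2 / (2 * \<mu>) - 1 / \<eta> 1) * p\<^sup>2 - r\<^sup>2 / 4"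
    by (simp add: q_def c_def algebra_simps)
  finally show ?thesis using xbar_1 by (simp add: p_def r_def)
qed

end

section \<open>Averaging over the iterations\<close>

lemma sum_Icc_1_1: "(\<Sum>t=1..1. h t) = h (1::nat)"
  by simp

lemma sum_Icc_1_Suc: "(\<Sum>t=1..Suc k. h t) = (\<Sum>t=1..k. h t) + h (Suc k)"
  for h :: "nat \<Rightarrow> 'a::comm_monoid_add"
  by simp

lemma sum_by_parts_from_1:
  fixes a b N :: "nat \<Rightarrow> real"
  assumes k: "1 \<le> k" and b: "b 1 = 0"
  shows "(\<Sum>t=1..k. a t * N t - b t * N (t - 1))
    = (\<Sum>t=1..k-1. (a t - b (t + 1)) * N t) + a k * N k"
  using k
proof (induction k rule: nat_induct_at_least)
  case base
  then show ?case using b by simp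
next
  case (Suc k)
  then obtain j where "k = Suc j" by (cases k) auto
  with Suc show ?case by (simp add: algebra_simps)
qed

lemma weighted_avg_convex_le:
  assumes w: "\<And>t. 1 \<le> t \<Longrightarrow> 0 < \<eta> t" and k: "1 \<le> (k::nat)"
    and v: "\<And>t. 1 \<le> t \<Longrightarrow> v t \<in> C" and h: "convex_on C h"
  shows "(\<Sum>t=1..k. \<eta> (t + 1)) * h (weighted_avg \<eta> v k) \<le> (\<Sum>t=1..k. \<eta> (t + 1) * h (v t))"
proof -
  define S where "S = (\<Sum>t=1..k. \<eta> (t + 1))"
  have S: "0 < S" unfolding S_def using k w by (intro sum_pos) auto
  have avg: "weighted_avg \<eta> v k = (\<Sum>t\<in>{1..k}. (\<eta> (t + 1) / S) *\<^sub>R v t)"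
    by (simp add: weighted_avg_def S_def scaleR_sum_right)
  have one: "(\<Sum>t\<in>{1..k}. \<eta> (t + 1) / S) = 1"
    using S by (simp add: S_def sum_divide_distrib[symmetric])
  have nonneg: "0 \<le> \<eta> (t + 1) / S" if "t \<in> {1..k}" for t
    using w[of "t + 1"] S by simp
  have "h (weighted_avg \<eta> v k) \<le> (\<Sum>t\<in>{1..k}. \<eta> (t + 1) / S * h (v t))"
    unfolding avg using one nonneg v k by (intro convex_on_sum[OF _ _ h]) auto
  also have "\<dots> = (\<Sum>t=1..k. \<eta> (t + 1) * h (v t)) / S"
    by (simp add: sum_divide_distrib)
  finally show "S * h (weighted_avg \<eta> v k) \<le> (\<Sum>t=1..k. \<eta> (t + 1) * h (v t))"
    using S by (simp add: field_simps)
qed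

context ac_pdhg_run
begin

abbreviation "weight_sum k \<equiv> \<Sum>t=1..k. \<eta> (t + 1)"

lemma weight_sum_pos: "1 \<le> k \<Longrightarrow> 0 < weight_sum k"
  by (intro sum_pos eta_pos) auto

lemma gap_weighted_avg_le:
  assumes k: "1 \<le> k"
  shows "weight_sum k * gap A f g (weighted_avg \<eta> x k, weighted_avg \<eta> y k) (u, v)
    \<le> (\<Sum>t=1..k. \<eta> (t + 1) * gap A f g (x t, y t) (u, v))"
proof -
  define F where "F w = f w + (A *v w) \<bullet> v" for w
  define G where "G w = g w + - ((A *v u) \<bullet> w)" for w
  have "convex_on X F"
    unfolding F_def using convex_X
    by (intro convex_on_add convex_f)
      (auto simp: convex_on_def inner_simps matrix_vector_right_distrib matrix_vector_mult_scaleR)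
  then have "weight_sum k * F (weighted_avg \<eta> x k) \<le> (\<Sum>t=1..k. \<eta> (t + 1) * F (x t))"
    by (intro weighted_avg_convex_le[where C = X] eta_pos k x_in)
  moreover have "convex_on Y G"
    unfolding G_def using convex_Y
    by (intro convex_on_add convex_g) (auto simp: convex_on_def inner_simps algebra_simps)
  then have "weight_sum k * G (weighted_avg \<eta> y k) \<le> (\<Sum>t=1..k. \<eta> (t + 1) * G (y t))"
    by (intro weighted_avg_convex_le[where C = Y] eta_pos k y_in)
  moreover have split: "gap A f g (w, z) (u, v) = F w + G z + (- g v - f u)" for w z
    by (simp add: gap_def lagrangian_def F_def G_def)
  moreover have "(\<Sum>t=1..k. \<eta> (t + 1) * gap A f g (x t, y t) (u, v))
      = (\<Sum>t=1..k. \<eta> (t + 1) * F (x t)) + (\<Sum>t=1..k. \<eta> (t + 1) * G (y t))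
        + weight_sum k * (- g v - f u)"
    unfolding split distrib_left sum.distrib sum_distrib_right ..
  ultimately show ?thesis unfolding split distrib_left by linarith
qed

text \<open>
  Summation by parts collects the coefficients of \<open>|y t - v|\<^sup>2\<close>; they are the weights of
  \<^const>\<open>ytilde\<close>. The same summation with all distances replaced by \<open>1\<close> gives their total.
\<close>

lemma ytilde_norm_sq_le:
  assumes k: "1 \<le> k"
  shows "\<mu> * weight_sum k * (norm (ytilde \<mu> \<eta> \<tau> y k - v))\<^sup>2
    \<le> (\<Sum>t=1..k. \<eta> (t + 1) * ((\<mu> + \<tau> t) * (norm (y t - v))\<^sup>2 - \<tau> t * (norm (y (t - 1) - v))\<^sup>2))"
proof -
  define a where "a t = \<eta> (t + 1) * (\<mu> + \<tau> t)" for t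
  define b where "b t = \<eta> (t + 1) * \<tau> t" for t
  define w where "w t = (if t < k then a t - b (t + 1) else a t)" for t
  obtain j where j: "k = Suc j" using k by (cases k) auto
  have b1: "b 1 = 0" using tau_1 by (simp add: b_def)
  have w_nonneg: "0 \<le> w t" if "t \<in> {1..k}" for t
    using that eta_tau_weight_nonneg[of t] eta_pos[of "t + 1"] tau_nonneg[of t] \<mu>_pos
    by (auto simp: w_def a_def b_def)
  have w_sum: "(\<Sum>t\<in>{1..k}. w t * N t) = (\<Sum>t=1..k. a t * N t - b t * N (t - 1))" for N
    unfolding sum_by_parts_from_1[OF k, of b, OF b1] by (simp add: j w_def)
  have total: "sum w {1..k} = \<mu> * weight_sum k"
    using w_sum[of "\<lambda>_. 1"] by (simp add: a_def b_def sum_distrib_left algebra_simps)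
  have yt: "ytilde \<mu> \<eta> \<tau> y k = (1 / (\<mu> * weight_sum k)) *\<^sub>R (\<Sum>t\<in>{1..k}. w t *\<^sub>R y t)"
    by (simp add: ytilde_def j w_def a_def b_def)
  have "\<mu> * weight_sum k * (norm (ytilde \<mu> \<eta> \<tau> y k - v))\<^sup>2 \<le> (\<Sum>t\<in>{1..k}. w t * (norm (y t - v))\<^sup>2)"
    unfolding yt using w_nonneg total weight_sum_pos[OF k] \<mu>_pos
    by (intro weighted_mean_norm_sq_le) auto
  then show ?thesis unfolding w_sum by (simp add: a_def b_def algebra_simps)
qed

lemma summed_steps_le:
  assumes k: "1 \<le> k" and u: "u \<in> X" and v: "v \<in> Y"
  shows "(\<Sum>t=1..k. \<eta> (t + 1) * (gap A f g (x t, y t) (u, v)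
          + \<mu> / 2 * (norm (ytil0 - y t))\<^sup>2 - \<mu> / 2 * (norm (ytil0 - v))\<^sup>2)
        + \<eta> (t + 1) / 2 * ((\<mu> + \<tau> t) * (norm (y t - v))\<^sup>2 - \<tau> t * (norm (y (t - 1) - v))\<^sup>2))
    \<le> gap_bracket A \<mu> \<beta> \<eta> x xbar y k u / 2 - (norm (x (k + 1) - xbar k))\<^sup>2 / 4"
  using k
proof (induction k rule: nat_induct_at_least)
  case base
  define E where "E = \<eta> 2 * (5 * (L 1)\<^sup>2 / (2 * \<mu>) - 1 / \<eta> 1) * (norm (x 1 - x 0))\<^sup>2"
  have "residual 1 \<le> E / 2 - (norm (x 2 - xbar 1))\<^sup>2 / 4"
    using residual_1_le by (simp add: E_def)
  moreover have "gap_bracket A \<mu> \<beta> \<eta> x xbar y 1 u / 2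
      = ((norm (xbar 1 - u))\<^sup>2 - (norm (xbar 2 - u))\<^sup>2) / (2 * \<beta>) + E / 2"
    unfolding gap_bracket_def E_def xbar_1 by (simp add: add_divide_distrib mult.commute[of 2 \<beta>] numeral_2_eq_2)
  ultimately show ?case
    using one_step[of 1, OF _ u v] unfolding sum_Icc_1_1 one_add_one by linarith
next
  case (Suc k)
  have two_le: "2 \<le> Suc k" using Suc(1) by simp
  have "gap_bracket A \<mu> \<beta> \<eta> x xbar y (Suc k) u / 2 = gap_bracket A \<mu> \<beta> \<eta> x xbar y k u / 2
      + ((norm (xbar (Suc k) - u))\<^sup>2 - (norm (xbar (Suc k + 1) - u))\<^sup>2) / (2 * \<beta>)"
    by (simp add: gap_bracket_def add_divide_distrib diff_divide_distrib mult.commute)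
  then show ?case
    using one_step[of "Suc k", OF _ u v] residual_le[OF two_le] Suc(2)
    unfolding sum_Icc_1_Suc unfolding Suc_eq_plus1 add_diff_cancel_right' by linarith
qed

lemma gap_lhs_le:
  assumes k: "1 \<le> k" and u: "u \<in> X" and v: "v \<in> Y"
  shows "gap_lhs A f g \<mu> \<eta> \<tau> ytil0 x y k u v
    \<le> 1 / (2 * weight_sum k) * gap_bracket A \<mu> \<beta> \<eta> x xbar y k u"
proof -
  define S where "S = weight_sum k"
  have S: "0 < S" using weight_sum_pos[OF k] by (simp add: S_def)
  have yhat: "S * (norm (weighted_avg \<eta> y k - ytil0))\<^sup>2 \<le> (\<Sum>t=1..k. \<eta> (t + 1) * (norm (y t - ytil0))\<^sup>2)"
    unfolding weighted_avg_def S_def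
    by (rule weighted_mean_norm_sq_le[OF _ refl weight_sum_pos[OF k]]) (rule less_imp_le, rule eta_pos, simp)
  define P where "P = (\<Sum>t=1..k. \<eta> (t + 1) * gap A f g (x t, y t) (u, v))"
  define N where "N = (\<Sum>t=1..k. \<eta> (t + 1) * (norm (y t - ytil0))\<^sup>2)"
  define T where "T = (\<Sum>t=1..k. \<eta> (t + 1)
      * ((\<mu> + \<tau> t) * (norm (y t - v))\<^sup>2 - \<tau> t * (norm (y (t - 1) - v))\<^sup>2))"
  have "(\<Sum>t=1..k. \<eta> (t + 1) * (gap A f g (x t, y t) (u, v)
          + \<mu> / 2 * (norm (ytil0 - y t))\<^sup>2 - \<mu> / 2 * (norm (ytil0 - v))\<^sup>2)
        + \<eta> (t + 1) / 2 * ((\<mu> + \<tau> t) * (norm (y t - v))\<^sup>2 - \<tau> t * (norm (y (t - 1) - v))\<^sup>2))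
      = (\<Sum>t=1..k. \<eta> (t + 1) * gap A f g (x t, y t) (u, v)
          + \<mu> / 2 * (\<eta> (t + 1) * (norm (y t - ytil0))\<^sup>2)
          - \<eta> (t + 1) * (\<mu> / 2 * (norm (ytil0 - v))\<^sup>2)
          + 1 / 2 * (\<eta> (t + 1)
              * ((\<mu> + \<tau> t) * (norm (y t - v))\<^sup>2 - \<tau> t * (norm (y (t - 1) - v))\<^sup>2)))"
    by (intro sum.cong refl) (simp add: norm_minus_commute[of ytil0] algebra_simps)
  also have "\<dots> = P + \<mu> / 2 * N - S * (\<mu> / 2 * (norm (ytil0 - v))\<^sup>2) + 1 / 2 * T"
    unfolding P_def N_def T_def S_def
    by (simp only: sum.distrib sum_subtractf sum_distrib_left sum_distrib_right)
  finally have "P + \<mu> / 2 * N - S * (\<mu> / 2 * (norm (ytil0 - v))\<^sup>2) + 1 / 2 * T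
      \<le> gap_bracket A \<mu> \<beta> \<eta> x xbar y k u / 2"
    using summed_steps_le[OF k u v] zero_le_power2[of "norm (x (k + 1) - xbar k)"] by linarith
  moreover have "S * gap A f g (weighted_avg \<eta> x k, weighted_avg \<eta> y k) (u, v) \<le> P"
    using gap_weighted_avg_le[OF k] by (simp add: P_def S_def)
  moreover have "\<mu> / 2 * (S * (norm (ytil0 - weighted_avg \<eta> y k))\<^sup>2) \<le> \<mu> / 2 * N"
    using yhat \<mu>_pos unfolding N_def norm_minus_commute[of ytil0] by (intro mult_left_mono) auto
  moreover have "\<mu> * S * (norm (ytilde \<mu> \<eta> \<tau> y k - v))\<^sup>2 \<le> T"
    using ytilde_norm_sq_le[OF k] by (simp add: T_def S_def)
  ultimately have "S * gap_lhs A f g \<mu> \<eta> \<tau> ytil0 x y k u v \<le> gap_bracket A \<mu> \<beta> \<eta> x xbar y k u / 2"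
    by (simp add: gap_lhs_def algebra_simps)
  then show ?thesis using S unfolding S_def[symmetric] by (simp add: field_simps)
qed

lemma rate_denominator_pos:
  assumes "2 \<le> k"
  shows "0 < 6 * real k + \<alpha> * real k * (real k - 3)"
proof -
  have "\<alpha> * (3 - real k) \<le> 1"
    using \<alpha>_le \<alpha>_pos assms by (cases "3 \<le> k") (auto intro: mult_le_one order_trans[OF mult_nonneg_nonpos])
  then have "0 < real k * (6 + \<alpha> * (real k - 3))"
    using assms by (intro mult_pos_pos) (auto simp: algebra_simps)
  then show ?thesis by (simp add: algebra_simps)
qed

lemma weight_sum_ge:
  "\<mu> * (6 * real k + \<alpha> * real k * (real k - 3)) / (24 * (Lmax k)\<^sup>2) \<le> weight_sum k"
proof -
  have eq: "(\<Sum>t=1..k. (3 + \<alpha> * (real t - 2))) = (6 * real k + \<alpha> * real k * (real k - 3)) / 2"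
    by (induction k) (auto simp: field_simps)
  have "\<mu> * (6 * real k + \<alpha> * real k * (real k - 3)) / (24 * (Lmax k)\<^sup>2)
      = (\<Sum>t=1..k. (3 + \<alpha> * (real t - 2))) * (\<mu> / (12 * (Lmax k)\<^sup>2))"
    unfolding eq by simp
  also have "\<dots> = (\<Sum>t=1..k. (3 + \<alpha> * (real t - 2)) * (\<mu> / (12 * (Lmax k)\<^sup>2)))"
    by (rule sum_distrib_right)
  also have "\<dots> \<le> weight_sum k"
  proof (rule sum_mono)
    fix t assume t: "t \<in> {1..k}"
    have "0 \<le> 3 + \<alpha> * (real t - 2)"
      using \<alpha>_pos \<alpha>_le t by (cases "t = 1") auto
    moreover have "(Lmax t)\<^sup>2 \<le> (Lmax k)\<^sup>2"
      using t by (intro power_mono Lmax_mono less_imp_le[OF Lmax_pos]) auto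
    then have "\<mu> / (12 * (Lmax k)\<^sup>2) \<le> \<mu> / (12 * (Lmax t)\<^sup>2)"
      using \<mu>_pos Lmax_pos[of t] Lmax_pos[of k] by (intro divide_left_mono) auto
    ultimately have "(3 + \<alpha> * (real t - 2)) * (\<mu> / (12 * (Lmax k)\<^sup>2))
        \<le> (3 + \<alpha> * (real t - 2)) * (\<mu> / (12 * (Lmax t)\<^sup>2))"
      by (rule mult_left_mono[rotated])
    also have "\<dots> \<le> \<eta> (t + 1)"
      using eta_lower_bound[of "t + 1"] t by simp
    finally show "(3 + \<alpha> * (real t - 2)) * (\<mu> / (12 * (Lmax k)\<^sup>2)) \<le> \<eta> (t + 1)" .
  qed
  finally show ?thesis .
qed

lemma inverse_weight_sum_le_rate:
  assumes k: "2 \<le> k"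
  shows "1 / (2 * weight_sum k) \<le> rate A y \<mu> \<alpha> \<beta> (\<eta> 1) k"
proof -
  define B where "B = \<mu> * (6 * real k + \<alpha> * real k * (real k - 3)) / (24 * (Lmax k)\<^sup>2)"
  have "0 < B"
    unfolding B_def using rate_denominator_pos[OF k] \<mu>_pos Lmax_pos
    by (intro divide_pos_pos mult_pos_pos zero_less_power) auto
  moreover have "B \<le> weight_sum k" unfolding B_def by (rule weight_sum_ge)
  ultimately have "1 / (2 * weight_sum k) \<le> 1 / (2 * B)"
    by (intro divide_left_mono) auto
  also have "\<dots> = rate A y \<mu> \<alpha> \<beta> (\<eta> 1) k"
    by (simp add: B_def rate_def)
  finally show ?thesis .
qed

text \<open>
  Since \<open>\<eta> 2 (L 1)\<^sup>2 / \<mu> \<le> 1 / 4\<close>, the coefficient of \<open>|x 1 - x 0|\<^sup>2\<close> is at most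
  \<open>5 / 2 * 1 / 4 = 5 / 8\<close>.
\<close>

lemma gap_bracket_le_diameter:
  assumes D: "\<And>u. u \<in> X \<Longrightarrow> (norm (u - x 0))\<^sup>2 \<le> D_X\<^sup>2" and u: "u \<in> X"
  shows "gap_bracket A \<mu> \<beta> \<eta> x xbar y k u \<le> (1 / \<beta> + 5 / 8) * D_X\<^sup>2"
proof -
  have "((norm (x 0 - u))\<^sup>2 - (norm (xbar (k + 1) - u))\<^sup>2) / \<beta> \<le> D_X\<^sup>2 / \<beta>"
  proof (rule divide_right_mono)
    show "(norm (x 0 - u))\<^sup>2 - (norm (xbar (k + 1) - u))\<^sup>2 \<le> D_X\<^sup>2"
      using D[OF u] zero_le_power2[of "norm (xbar (k + 1) - u)"]
      unfolding norm_minus_commute[of "x 0" u] by linarith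
  qed (use \<beta>_pos in simp)
  moreover have "\<eta> 2 * (5 * (L 1)\<^sup>2 / (2 * \<mu>) - 1 / \<eta> 1) \<le> 5 / 8"
  proof -
    have "\<eta> 2 * (L 1)\<^sup>2 / \<mu> \<le> 1 / 4" using eta_2_le \<mu>_pos by (simp add: field_simps)
    moreover have "0 \<le> \<eta> 2 / \<eta> 1" using eta_1_pos eta_2_pos by simp
    moreover have "\<eta> 2 * (5 * (L 1)\<^sup>2 / (2 * \<mu>) - 1 / \<eta> 1) = 5 / 2 * (\<eta> 2 * (L 1)\<^sup>2 / \<mu>) - \<eta> 2 / \<eta> 1"
      by (simp add: algebra_simps)
    ultimately show ?thesis by linarith
  qed
  then have "\<eta> 2 * (5 * (L 1)\<^sup>2 / (2 * \<mu>) - 1 / \<eta> 1) * (norm (x 1 - x 0))\<^sup>2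
      \<le> 5 / 8 * (norm (x 1 - x 0))\<^sup>2"
    by (intro mult_right_mono) auto
  moreover have "(1 / \<beta> + 5 / 8) * D_X\<^sup>2 = D_X\<^sup>2 / \<beta> + 5 / 8 * D_X\<^sup>2"
    by (simp add: algebra_simps)
  ultimately show ?thesis
    using D[OF x_in[of 1]] unfolding gap_bracket_def by linarith
qed

lemma gap_le_diameter:
  assumes k: "2 \<le> k"
    and DX: "\<And>u. u \<in> X \<Longrightarrow> (norm (u - x 0))\<^sup>2 \<le> D_X\<^sup>2"
    and DY: "\<And>v. v \<in> Y \<Longrightarrow> (norm (v - ytil0))\<^sup>2 \<le> D_Y\<^sup>2"
    and u: "u \<in> X" and v: "v \<in> Y"
  shows "gap A f g (weighted_avg \<eta> x k, weighted_avg \<eta> y k) (u, v)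
    \<le> rate A y \<mu> \<alpha> \<beta> (\<eta> 1) k * (1 / \<beta> + 5 / 8) * D_X\<^sup>2 + \<mu> / 2 * D_Y\<^sup>2"
proof -
  define C where "C = (1 / \<beta> + 5 / 8) * D_X\<^sup>2"
  have k1: "1 \<le> k" using k by simp
  have "gap_lhs A f g \<mu> \<eta> \<tau> ytil0 x y k u v \<le> 1 / (2 * weight_sum k) * gap_bracket A \<mu> \<beta> \<eta> x xbar y k u"
    by (rule gap_lhs_le[OF k1 u v])
  also have "\<dots> \<le> 1 / (2 * weight_sum k) * C"
    using weight_sum_pos[OF k1] gap_bracket_le_diameter[OF DX u, of k]
    by (intro mult_left_mono) (auto simp: C_def)
  also have "\<dots> \<le> rate A y \<mu> \<alpha> \<beta> (\<eta> 1) k * C"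
    using inverse_weight_sum_le_rate[OF k] \<beta>_pos by (intro mult_right_mono) (auto simp: C_def)
  finally have "gap_lhs A f g \<mu> \<eta> \<tau> ytil0 x y k u v \<le> rate A y \<mu> \<alpha> \<beta> (\<eta> 1) k * C" .
  moreover have "\<mu> / 2 * (norm (ytil0 - v))\<^sup>2 \<le> \<mu> / 2 * D_Y\<^sup>2"
    using DY[OF v] \<mu>_pos by (intro mult_left_mono) (auto simp: norm_minus_commute[of ytil0])
  moreover have "0 \<le> \<mu> / 2 * (norm (ytil0 - weighted_avg \<eta> y k))\<^sup>2"
    "0 \<le> \<mu> / 2 * (norm (ytilde \<mu> \<eta> \<tau> y k - v))\<^sup>2"
    using \<mu>_pos by auto
  ultimately show ?thesis
    unfolding gap_lhs_def C_def mult.assoc by linarith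
qed

end

text \<open>
  The gap separates into a function of \<open>u\<close> and a function of \<open>v\<close>, each the negative of a lower
  semicontinuous function.
\<close>

lemma gap_attains_max:
  assumes "compact X" "X \<noteq> {}" "compact Y" "Y \<noteq> {}" "lsc_on X f" "lsc_on Y g"
  shows "\<exists>z\<in>X \<times> Y. \<forall>z'\<in>X \<times> Y. gap A f g zb z' \<le> gap A f g zb z"
proof -
  have "\<exists>u\<in>X. \<forall>u'\<in>X. f u + (A *v u) \<bullet> snd zb \<le> f u' + (A *v u') \<bullet> snd zb"
    using assms
    by (intro lsc_on_compact_attains_min lsc_on_add_continuous continuous_intros
        linear_continuous_on linear_conv_bounded_linear[THEN iffD1]) auto
  then obtain u where u: "u \<in> X" "\<And>u'. u' \<in> X \<Longrightarrow> f u + (A *v u) \<bullet> snd zb \<le> f u' + (A *v u') \<bullet> snd zb"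
    by blast
  have "\<exists>v\<in>Y. \<forall>v'\<in>Y. g v + - ((A *v fst zb) \<bullet> v) \<le> g v' + - ((A *v fst zb) \<bullet> v')"
    using assms by (intro lsc_on_compact_attains_min lsc_on_add_continuous continuous_intros)
  then obtain v where v: "v \<in> Y"
      "\<And>v'. v' \<in> Y \<Longrightarrow> g v + - ((A *v fst zb) \<bullet> v) \<le> g v' + - ((A *v fst zb) \<bullet> v')"
    by blast
  have "gap A f g zb z' \<le> gap A f g zb (u, v)" if "z' \<in> X \<times> Y" for z'
    using u(2)[of "fst z'"] v(2)[of "snd z'"] that by (auto simp: gap_def lagrangian_def)
  with u v show ?thesis by blast
qed

lemma bounded_if_norm_sq_diff_le:
  fixes S :: "'a::real_normed_vector set"
  assumes "\<And>u. u \<in> S \<Longrightarrow> (norm (u - a))\<^sup>2 \<le> D\<^sup>2"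
  shows "bounded S"
  unfolding bounded_def
  using assms by (intro exI[of _ a] exI[of _ "\<bar>D\<bar>"]) (auto simp: dist_norm norm_minus_commute abs_le_square_iff[symmetric])

theorem corollary2p4:
  fixes X :: "(real^'n) set" and Y :: "(real^'m) set" and A :: "real^'n^'m"
    and f :: "real^'n \<Rightarrow> real" and g :: "real^'m \<Rightarrow> real"
    and \<mu> \<alpha> \<beta> :: real and \<beta>s \<eta> \<tau> :: "nat \<Rightarrow> real"
    and ytil0 :: "real^'m" and x xbar :: "nat \<Rightarrow> real^'n" and y :: "nat \<Rightarrow> real^'m"
  assumes "X \<noteq> {}" and "closed X" and "convex X"
    and "Y \<noteq> {}" and "closed Y" and "convex Y"
    and "convex_on X f" and "lsc_on X f"
    and "convex_on Y g" and "lsc_on Y g"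
    and "\<exists>z. saddle_point X Y A f g z"
    and "\<mu> > 0" and "0 < \<alpha>" and "\<alpha> \<le> 1" and "0 < \<beta>" and "\<beta> \<le> 1 - sqrt 6 / 3"
    and "ac_pdhg X Y A f g \<mu> \<beta>s \<eta> \<tau> ytil0 x xbar y"
    and "ac_pdhg_steps A y \<mu> \<alpha> \<beta> \<beta>s \<eta> \<tau>"
  shows "(\<forall>t\<ge>2. \<eta> t \<ge> (3 + \<alpha> * (real t - 3)) * \<mu>
                        / (12 * (max_local_norm A y \<mu> \<beta> (\<eta> 1) (t - 1))\<^sup>2))
    \<and> (\<forall>k\<ge>2. \<forall>u\<in>X. \<forall>v\<in>Y.
         gap_lhs A f g \<mu> \<eta> \<tau> ytil0 x y k u v
           \<le> 1 / (2 * (\<Sum>t=1..k. \<eta> (t + 1))) * gap_bracket A \<mu> \<beta> \<eta> x xbar y k u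
         \<and> (gap_bracket A \<mu> \<beta> \<eta> x xbar y k u \<ge> 0 \<longrightarrow>
              gap_lhs A f g \<mu> \<eta> \<tau> ytil0 x y k u v
                \<le> rate A y \<mu> \<alpha> \<beta> (\<eta> 1) k * gap_bracket A \<mu> \<beta> \<eta> x xbar y k u))
    \<and> (\<forall>D_X D_Y. (\<forall>u\<in>X. (norm (u - x 0))\<^sup>2 \<le> D_X\<^sup>2) \<longrightarrow>
                  (\<forall>v\<in>Y. (norm (v - ytil0))\<^sup>2 \<le> D_Y\<^sup>2) \<longrightarrow>
         (\<forall>k\<ge>2. \<exists>z\<in>X \<times> Y.
            (\<forall>z'\<in>X \<times> Y. gap A f g (weighted_avg \<eta> x k, weighted_avg \<eta> y k) z'
                        \<le> gap A f g (weighted_avg \<eta> x k, weighted_avg \<eta> y k) z)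
            \<and> gap A f g (weighted_avg \<eta> x k, weighted_avg \<eta> y k) z
                \<le> rate A y \<mu> \<alpha> \<beta> (\<eta> 1) k * (1 / \<beta> + 5 / 8) * D_X\<^sup>2 + \<mu> / 2 * D_Y\<^sup>2))"
proof -
  interpret ac_pdhg_run X Y A f g \<mu> \<alpha> \<beta> \<beta>s \<eta> \<tau> ytil0 x xbar y
    using assms by unfold_locales
  have "gap_lhs A f g \<mu> \<eta> \<tau> ytil0 x y k u v
      \<le> rate A y \<mu> \<alpha> \<beta> (\<eta> 1) k * gap_bracket A \<mu> \<beta> \<eta> x xbar y k u"
    if "2 \<le> k" "u \<in> X" "v \<in> Y" "0 \<le> gap_bracket A \<mu> \<beta> \<eta> x xbar y k u" for k u v
    using gap_lhs_le[of k u v] mult_right_mono[OF inverse_weight_sum_le_rate[of k]] that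
    by fastforce
  moreover have "\<exists>z\<in>X \<times> Y.
      (\<forall>z'\<in>X \<times> Y. gap A f g (weighted_avg \<eta> x k, weighted_avg \<eta> y k) z'
                  \<le> gap A f g (weighted_avg \<eta> x k, weighted_avg \<eta> y k) z)
      \<and> gap A f g (weighted_avg \<eta> x k, weighted_avg \<eta> y k) z
          \<le> rate A y \<mu> \<alpha> \<beta> (\<eta> 1) k * (1 / \<beta> + 5 / 8) * D_X\<^sup>2 + \<mu> / 2 * D_Y\<^sup>2"
    if DX: "\<forall>u\<in>X. (norm (u - x 0))\<^sup>2 \<le> D_X\<^sup>2" and DY: "\<forall>v\<in>Y. (norm (v - ytil0))\<^sup>2 \<le> D_Y\<^sup>2"
      and k: "2 \<le> k" for D_X D_Y k
  proof -
    have "compact X" "compact Y"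
      using assms DX DY by (auto simp: compact_eq_bounded_closed intro: bounded_if_norm_sq_diff_le)
    then obtain z where "z \<in> X \<times> Y" "\<forall>z'\<in>X \<times> Y.
        gap A f g (weighted_avg \<eta> x k, weighted_avg \<eta> y k) z'
          \<le> gap A f g (weighted_avg \<eta> x k, weighted_avg \<eta> y k) z"
      using gap_attains_max[of X Y f g] assms by blast
    moreover from this have "gap A f g (weighted_avg \<eta> x k, weighted_avg \<eta> y k) z
        \<le> rate A y \<mu> \<alpha> \<beta> (\<eta> 1) k * (1 / \<beta> + 5 / 8) * D_X\<^sup>2 + \<mu> / 2 * D_Y\<^sup>2"
      using gap_le_diameter[OF k, of D_X D_Y "fst z" "snd z"] DX DY by (auto simp: mem_Times_iff)
    ultimately show ?thesis by blast
  qed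
  ultimately show ?thesis
    using eta_lower_bound gap_lhs_le by auto
qed

end
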